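(* Let $\alpha,\beta,\gamma,\delta\in\mathbb{R}$ with $\alpha+\delta\neq0$ and $\alpha\gamma=0$, and let $(G_7,g,J)$ be the connected three-dimensional non-unimodular Lie group with left-invariant Lorentzian metric $g$ whose Lie algebra has a pseudo-orthonormal basis $\{e_1,e_2,e_3\}$, $e_3$ timelike, with $$[e_1,e_2]=-\alpha e_1-\beta e_2-\beta e_3,\quad [e_1,e_3]=\alpha e_1+\beta e_2+\beta e_3,\quad [e_2,e_3]=\gamma e_1+\delta e_2+\delta e_3,$$ and with the product structure $J$ given by $Je_1=e_1$, $Je_2=e_2$, $Je_3=-e_3$. Then $(G_7,g,J)$ admits left-invariant Ricci collineations associated to the Kobayashi-Nomizu connection $\nabla^1$ if and only if one of the following holds, and in each case the space $\mathbb{V}_{\mathbb{RC}}$ of these collineations is as indicated: (1) $\alpha=0$, $\delta\neq0$, $\beta\neq0$, $\gamma=0$, with $\mathbb{V}_{\mathbb{RC}}=\langle e_1-\frac{\beta}{\delta}e_2-\frac{\beta}{\delta}e_3\rangle$ (i.e. $\lambda_2=\lambda_3=-\frac{\beta}{\delta}\lambda_1$); (2) $\alpha=0$, $\delta\neq0$, $\beta=0$, with $\mathbb{V}_{\mathbb{RC}}=\langle e_1\rangle$ (i.e. $\lambda_2=\lambda_3=0$); (3) $\alpha\neq0$, $\gamma=0$, $\delta=0$, with $\mathbb{V}_{\mathbb{RC}}=\langle e_2+e_3\rangle$ (i.e. $\lambda_1=0$, $\lambda_2=\lambda_3$).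
   Context: Pseudo-orthonormal with $e_3$ timelike means $g(e_1,e_1)=g(e_2,e_2)=1$, $g(e_3,e_3)=-1$, $g(e_i,e_j)=0$ for $i\ne j$. $J$ is extended left-invariantly to a $(1,1)$-tensor with $J^2=\mathrm{id}$. Let $\nabla$ be the Levi-Civita connection of $g$. The canonical connection is $\nabla^0_XY=\nabla_XY-\frac12(\nabla_XJ)JY$, and the Kobayashi-Nomizu connection is $$\nabla^1_XY=\nabla^0_XY-\tfrac14\big[(\nabla_YJ)JX-(\nabla_{JY}J)X\big],$$ with curvature $R^1(X,Y)Z=\nabla^1_X\nabla^1_YZ-\nabla^1_Y\nabla^1_XZ-\nabla^1_{[X,Y]}Z$. Its Ricci tensor is $$\mathrm{Ric}^1(X,Y)=-g(R^1(X,e_1)Y,e_1)-g(R^1(X,e_2)Y,e_2)+g(R^1(X,e_3)Y,e_3),$$ and its symmetrization is $\widetilde{\mathrm{Ric}}^1(X,Y)=\frac12\big(\mathrm{Ric}^1(X,Y)+\mathrm{Ric}^1(Y,X)\big)$. For a left-invariant vector field $\xi=\lambda_1e_1+\lambda_2e_2+\lambda_3e_3$ ($\lambda_i\in\mathbb{R}$), $$(L_\xi\widetilde{\mathrm{Ric}}^1)(X,Y)=\xi\big(\widetilde{\mathrm{Ric}}^1(X,Y)\big)-\widetilde{\mathrm{Ric}}^1([\xi,X],Y)-\widetilde{\mathrm{Ric}}^1(X,[\xi,Y]).$$ A left-invariant Ricci collineation associated to $\nabla^1$ is a left-invariant $\xi$ with $L_\xi\widetilde{\mathrm{Ric}}^1=0$;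 $\mathbb{V}_{\mathbb{RC}}$ denotes the real vector space of all of them, and $\langle\cdot\rangle$ denotes linear span. The group admits left-invariant Ricci collineations if there is a nonzero such $\xi$. *)

theory Defs
  imports "HOL-Analysis.Analysis" "HOL-Library.Function_Algebras"
begin

text \<open>
  Together with \<^theory>\<open>HOL-Library.Function_Algebras\<close>, the following makes spaces of functions
  real vector spaces under the pointwise operations, so that \<^const>\<open>span\<close> and
  \<^const>\<open>independent\<close> apply to tangent vectors and to vector fields.
\<close>

instantiation "fun" :: (type, real_vector) real_vector
begin

definition scaleR_fun :: "real \<Rightarrow> ('a \<Rightarrow> 'b) \<Rightarrow> 'a \<Rightarrow> 'b"
  where "scaleR_fun c f = (\<lambda>x. c *\<^sub>R f x)"

instance
  by standard (simp_all add: scaleR_fun_def fun_eq_iff scaleR_add_right scaleR_add_left)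

end


section \<open>Smooth maps and Lie groups\<close>

text \<open>The domain \<open>S\<close> is meant to be open.\<close>

primrec Ck_on :: "nat \<Rightarrow> ('a::euclidean_space \<Rightarrow> 'b::real_normed_vector) \<Rightarrow> 'a set \<Rightarrow> bool" where
  "Ck_on 0 f S \<longleftrightarrow> continuous_on S f"
| "Ck_on (Suc k) f S \<longleftrightarrow>
     (\<forall>x\<in>S. f differentiable (at x)) \<and>
     (\<forall>i\<in>Basis. Ck_on k (\<lambda>x. frechet_derivative f (at x) i) S)"

definition Cinf_on :: "('a::euclidean_space \<Rightarrow> 'b::real_normed_vector) \<Rightarrow> 'a set \<Rightarrow> bool"
  where "Cinf_on f S \<longleftrightarrow> (\<forall>k. Ck_on k f S)"

text \<open>
  A chart is a pair \<open>(U, \<phi>)\<close>; only the values of \<open>\<phi>\<close> on \<open>U\<close> matter. Atlases are not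
  required to be maximal.
\<close>

type_synonym 'g atlas = "('g set \<times> ('g \<Rightarrow> real^3)) set"

definition smooth_atlas :: "('g::topological_space) atlas \<Rightarrow> bool" where
  "smooth_atlas A \<longleftrightarrow>
     (\<Union>(U, \<phi>)\<in>A. U) = UNIV \<and>
     (\<forall>(U, \<phi>)\<in>A. open U \<and> open (\<phi> ` U) \<and> homeomorphism U (\<phi> ` U) \<phi> (inv_into U \<phi>)) \<and>
     (\<forall>(U, \<phi>)\<in>A. \<forall>(V, \<psi>)\<in>A. Cinf_on (\<psi> \<circ> inv_into U \<phi>) (\<phi> ` (U \<inter> V)))"

text \<open>
  Lie groups of dimension 3. The group operation is written \<open>+\<close>, as in the class
  \<^class>\<open>topological_group_add\<close>, which does not assume commutativity; the identity is \<open>0\<close>.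
\<close>

definition lie_group ::
  "('g::{topological_group_add, t2_space, second_countable_topology}) atlas \<Rightarrow> bool" where
  "lie_group A \<longleftrightarrow>
     smooth_atlas A \<and>
     (\<forall>(U, \<phi>)\<in>A. \<forall>(V, \<psi>)\<in>A. \<forall>(W, \<theta>)\<in>A.
        Cinf_on (\<lambda>(a, b). \<theta> (inv_into U \<phi> a + inv_into V \<psi> b))
          {(\<phi> x, \<psi> y) |x y. x \<in> U \<and> y \<in> V \<and> x + y \<in> W}) \<and>
     (\<forall>(U, \<phi>)\<in>A. \<forall>(V, \<psi>)\<in>A.
        Cinf_on (\<lambda>a. \<psi> (- inv_into U \<phi> a)) {\<phi> x |x. x \<in> U \<and> - x \<in> V})"

definition smooth_functions :: "('g::topological_space) atlas \<Rightarrow> ('g \<Rightarrow> real) set" where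
  "smooth_functions A = {f. \<forall>(U, \<phi>)\<in>A. Cinf_on (f \<circ> inv_into U \<phi>) (\<phi> ` U)}"


section \<open>Tangent vectors and vector fields\<close>

text \<open>
  Tangent vectors at \<open>p\<close> and vector fields are derivations of the algebra of smooth functions.
  They are set to \<open>0\<close> outside this algebra, so that equality of HOL functions is equality of
  derivations.
\<close>

type_synonym 'g tvec = "('g \<Rightarrow> real) \<Rightarrow> real"
type_synonym 'g vfield = "('g \<Rightarrow> real) \<Rightarrow> ('g \<Rightarrow> real)"

definition tangent_space :: "('g::topological_space) atlas \<Rightarrow> 'g \<Rightarrow> 'g tvec set" where
  "tangent_space A p = {v.
     (\<forall>f. f \<notin> smooth_functions A \<longrightarrow> v f = 0) \<and>
     (\<forall>f\<in>smooth_functions A. \<forall>h\<in>smooth_functions A. v (f + h) = v f + v h) \<and>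
     (\<forall>c. \<forall>f\<in>smooth_functions A. v (c *\<^sub>R f) = c * v f) \<and>
     (\<forall>f\<in>smooth_functions A. \<forall>h\<in>smooth_functions A. v (f * h) = v f * h p + f p * v h)}"

definition vector_fields :: "('g::topological_space) atlas \<Rightarrow> 'g vfield set" where
  "vector_fields A = {X.
     (\<forall>f. f \<notin> smooth_functions A \<longrightarrow> X f = 0) \<and>
     (\<forall>f\<in>smooth_functions A. X f \<in> smooth_functions A) \<and>
     (\<forall>f\<in>smooth_functions A. \<forall>h\<in>smooth_functions A. X (f + h) = X f + X h) \<and>
     (\<forall>c. \<forall>f\<in>smooth_functions A. X (c *\<^sub>R f) = c *\<^sub>R X f) \<and>
     (\<forall>f\<in>smooth_functions A. \<forall>h\<in>smooth_functions A. X (f * h) = X f * h + f * X h)}"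

definition value_at :: "'g vfield \<Rightarrow> 'g \<Rightarrow> 'g tvec"
  where "value_at X p = (\<lambda>f. X f p)"

definition fmult :: "('g \<Rightarrow> real) \<Rightarrow> 'g vfield \<Rightarrow> 'g vfield"
  where "fmult h X = (\<lambda>f. h * X f)"

definition lie_bracket :: "'g vfield \<Rightarrow> 'g vfield \<Rightarrow> 'g vfield"
  where "lie_bracket X Y = (\<lambda>f. X (Y f) - Y (X f))"

text \<open>The differential of the left translation \<open>x \<mapsto> a + x\<close>, from \<open>T\<^sub>pG\<close> to the tangent space at
  \<open>a + p\<close>.\<close>

definition dL :: "'g::plus \<Rightarrow> 'g tvec \<Rightarrow> 'g tvec"
  where "dL a v = (\<lambda>f. v (\<lambda>x. f (a + x)))"

definition left_invariant_fields ::
  "('g::{topological_space, plus}) atlas \<Rightarrow> 'g vfield set" where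
  "left_invariant_fields A =
     {X \<in> vector_fields A. \<forall>a p. value_at X (a + p) = dL a (value_at X p)}"


section \<open>Left-invariant metrics and tensors\<close>

type_synonym 'g metric = "'g \<Rightarrow> 'g tvec \<Rightarrow> 'g tvec \<Rightarrow> real"
type_synonym 'g tensor11 = "'g \<Rightarrow> 'g tvec \<Rightarrow> 'g tvec"

definition metric_app :: "'g metric \<Rightarrow> 'g vfield \<Rightarrow> 'g vfield \<Rightarrow> 'g \<Rightarrow> real"
  where "metric_app g X Y = (\<lambda>p. g p (value_at X p) (value_at Y p))"

text \<open>
  The signature \<open>(+,+,-)\<close> is expressed by a timelike vector whose orthogonal complement is
  positive definite; this includes nondegeneracy.
\<close>

definition lorentzian_metric :: "('g::topological_space) atlas \<Rightarrow> 'g metric \<Rightarrow> bool" where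
  "lorentzian_metric A g \<longleftrightarrow>
     (\<forall>p. \<forall>u\<in>tangent_space A p. \<forall>v\<in>tangent_space A p. \<forall>w\<in>tangent_space A p. \<forall>c.
        g p (u + v) w = g p u w + g p v w \<and>
        g p (c *\<^sub>R u) w = c * g p u w \<and>
        g p u w = g p w u) \<and>
     (\<forall>p. \<exists>t\<in>tangent_space A p. g p t t < 0 \<and>
        (\<forall>v\<in>tangent_space A p. g p t v = 0 \<and> v \<noteq> 0 \<longrightarrow> g p v v > 0)) \<and>
     (\<forall>X\<in>vector_fields A. \<forall>Y\<in>vector_fields A. metric_app g X Y \<in> smooth_functions A)"

definition left_invariant_metric ::
  "('g::{topological_space, plus}) atlas \<Rightarrow> 'g metric \<Rightarrow> bool" where
  "left_invariant_metric A g \<longleftrightarrow>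
     (\<forall>a p. \<forall>u\<in>tangent_space A p. \<forall>v\<in>tangent_space A p.
        g (a + p) (dL a u) (dL a v) = g p u v)"

definition tensor_app :: "'g tensor11 \<Rightarrow> 'g vfield \<Rightarrow> 'g vfield"
  where "tensor_app J X = (\<lambda>f p. J p (value_at X p) f)"

definition tensor_field11 :: "('g::topological_space) atlas \<Rightarrow> 'g tensor11 \<Rightarrow> bool" where
  "tensor_field11 A J \<longleftrightarrow>
     (\<forall>p. \<forall>u\<in>tangent_space A p. \<forall>v\<in>tangent_space A p. \<forall>c.
        J p u \<in> tangent_space A p \<and>
        J p (u + v) = J p u + J p v \<and>
        J p (c *\<^sub>R u) = c *\<^sub>R J p u) \<and>
     (\<forall>X\<in>vector_fields A. tensor_app J X \<in> vector_fields A)"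

definition left_invariant_tensor11 ::
  "('g::{topological_space, plus}) atlas \<Rightarrow> 'g tensor11 \<Rightarrow> bool" where
  "left_invariant_tensor11 A J \<longleftrightarrow>
     (\<forall>a p. \<forall>v\<in>tangent_space A p. J (a + p) (dL a v) = dL a (J p v))"

definition product_structure :: "('g::topological_space) atlas \<Rightarrow> 'g tensor11 \<Rightarrow> bool" where
  "product_structure A J \<longleftrightarrow>
     tensor_field11 A J \<and> (\<forall>p. \<forall>v\<in>tangent_space A p. J p (J p v) = v)"

text \<open>
  The Lie algebra of the group is its tangent space at the identity, with the bracket of
  left-invariant vector fields; a basis is given by left-invariant fields whose values at the
  identity form a basis of that tangent space.
\<close>

definition lie_algebra_basis ::
  "('g::{topological_space, monoid_add}) atlas \<Rightarrow> 'g vfield \<Rightarrow> 'g vfield \<Rightarrow> 'g vfield \<Rightarrow> bool" where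
  "lie_algebra_basis A e\<^sub>1 e\<^sub>2 e\<^sub>3 \<longleftrightarrow>
     {e\<^sub>1, e\<^sub>2, e\<^sub>3} \<subseteq> left_invariant_fields A \<and>
     distinct [value_at e\<^sub>1 0, value_at e\<^sub>2 0, value_at e\<^sub>3 0] \<and>
     independent {value_at e\<^sub>1 0, value_at e\<^sub>2 0, value_at e\<^sub>3 0} \<and>
     span {value_at e\<^sub>1 0, value_at e\<^sub>2 0, value_at e\<^sub>3 0} = tangent_space A 0"

definition pseudo_orthonormal ::
  "'g metric \<Rightarrow> 'g vfield \<Rightarrow> 'g vfield \<Rightarrow> 'g vfield \<Rightarrow> bool" where
  "pseudo_orthonormal g e\<^sub>1 e\<^sub>2 e\<^sub>3 \<longleftrightarrow>
     metric_app g e\<^sub>1 e\<^sub>1 = 1 \<and> metric_app g e\<^sub>2 e\<^sub>2 = 1 \<and> metric_app g e\<^sub>3 e\<^sub>3 = - 1 \<and>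
     metric_app g e\<^sub>1 e\<^sub>2 = 0 \<and> metric_app g e\<^sub>1 e\<^sub>3 = 0 \<and> metric_app g e\<^sub>2 e\<^sub>3 = 0"


section \<open>Connections\<close>

type_synonym 'g connection = "'g vfield \<Rightarrow> 'g vfield \<Rightarrow> 'g vfield"

definition affine_connection :: "('g::topological_space) atlas \<Rightarrow> 'g connection \<Rightarrow> bool" where
  "affine_connection A D \<longleftrightarrow>
     (\<forall>X\<in>vector_fields A. \<forall>Y\<in>vector_fields A. D X Y \<in> vector_fields A) \<and>
     (\<forall>X\<in>vector_fields A. \<forall>X'\<in>vector_fields A. \<forall>Y\<in>vector_fields A.
        D (X + X') Y = D X Y + D X' Y) \<and>
     (\<forall>h\<in>smooth_functions A. \<forall>X\<in>vector_fields A. \<forall>Y\<in>vector_fields A.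
        D (fmult h X) Y = fmult h (D X Y)) \<and>
     (\<forall>X\<in>vector_fields A. \<forall>Y\<in>vector_fields A. \<forall>Y'\<in>vector_fields A.
        D X (Y + Y') = D X Y + D X Y') \<and>
     (\<forall>h\<in>smooth_functions A. \<forall>X\<in>vector_fields A. \<forall>Y\<in>vector_fields A.
        D X (fmult h Y) = fmult (X h) Y + fmult h (D X Y))"

definition levi_civita ::
  "('g::topological_space) atlas \<Rightarrow> 'g metric \<Rightarrow> 'g connection \<Rightarrow> bool" where
  "levi_civita A g D \<longleftrightarrow>
     affine_connection A D \<and>
     (\<forall>X\<in>vector_fields A. \<forall>Y\<in>vector_fields A. D X Y - D Y X = lie_bracket X Y) \<and>
     (\<forall>X\<in>vector_fields A. \<forall>Y\<in>vector_fields A. \<forall>Z\<in>vector_fields A.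
        X (metric_app g Y Z) = metric_app g (D X Y) Z + metric_app g Y (D X Z))"

text \<open>\<open>nabla_J D J X Y\<close> is \<open>(\<nabla>\<^sub>X J) Y\<close>.\<close>

definition nabla_J :: "'g connection \<Rightarrow> 'g tensor11 \<Rightarrow> 'g connection" where
  "nabla_J D J X Y = D X (tensor_app J Y) - tensor_app J (D X Y)"

definition canonical_connection :: "'g connection \<Rightarrow> 'g tensor11 \<Rightarrow> 'g connection" where
  "canonical_connection D J X Y = D X Y - (1/2) *\<^sub>R nabla_J D J X (tensor_app J Y)"

definition kobayashi_nomizu :: "'g connection \<Rightarrow> 'g tensor11 \<Rightarrow> 'g connection" where
  "kobayashi_nomizu D J X Y =
     canonical_connection D J X Y
     - (1/4) *\<^sub>R (nabla_J D J Y (tensor_app J X) - nabla_J D J (tensor_app J Y) X)"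

definition curvature ::
  "'g connection \<Rightarrow> 'g vfield \<Rightarrow> 'g vfield \<Rightarrow> 'g vfield \<Rightarrow> 'g vfield" where
  "curvature D X Y Z = D X (D Y Z) - D Y (D X Z) - D (lie_bracket X Y) Z"

text \<open>In the following, \<open>(e\<^sub>1, e\<^sub>2, e\<^sub>3)\<close> is a pseudo-orthonormal frame with \<open>e\<^sub>3\<close> timelike.\<close>

definition ricci ::
  "'g metric \<Rightarrow> 'g vfield \<Rightarrow> 'g vfield \<Rightarrow> 'g vfield \<Rightarrow> 'g connection \<Rightarrow>
   'g vfield \<Rightarrow> 'g vfield \<Rightarrow> 'g \<Rightarrow> real" where
  "ricci g e\<^sub>1 e\<^sub>2 e\<^sub>3 D X Y =
     - metric_app g (curvature D X e\<^sub>1 Y) e\<^sub>1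
     - metric_app g (curvature D X e\<^sub>2 Y) e\<^sub>2
     + metric_app g (curvature D X e\<^sub>3 Y) e\<^sub>3"

definition sym_ricci ::
  "'g metric \<Rightarrow> 'g vfield \<Rightarrow> 'g vfield \<Rightarrow> 'g vfield \<Rightarrow> 'g connection \<Rightarrow>
   'g vfield \<Rightarrow> 'g vfield \<Rightarrow> 'g \<Rightarrow> real" where
  "sym_ricci g e\<^sub>1 e\<^sub>2 e\<^sub>3 D X Y =
     (1/2) *\<^sub>R (ricci g e\<^sub>1 e\<^sub>2 e\<^sub>3 D X Y + ricci g e\<^sub>1 e\<^sub>2 e\<^sub>3 D Y X)"

definition lie_derivative2 ::
  "'g vfield \<Rightarrow> ('g vfield \<Rightarrow> 'g vfield \<Rightarrow> 'g \<Rightarrow> real) \<Rightarrow> 'g vfield \<Rightarrow> 'g vfield \<Rightarrow> 'g \<Rightarrow> real" where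
  "lie_derivative2 \<xi> T X Y = \<xi> (T X Y) - T (lie_bracket \<xi> X) Y - T X (lie_bracket \<xi> Y)"

text \<open>The space of left-invariant Ricci collineations associated to the Kobayashi-Nomizu
  connection; \<open>D\<close> is the Levi-Civita connection of \<open>g\<close>.\<close>

definition ricci_collineations ::
  "('g::{topological_space, plus}) atlas \<Rightarrow> 'g metric \<Rightarrow> 'g tensor11 \<Rightarrow> 'g connection \<Rightarrow>
   'g vfield \<Rightarrow> 'g vfield \<Rightarrow> 'g vfield \<Rightarrow> 'g vfield set" where
  "ricci_collineations A g J D e\<^sub>1 e\<^sub>2 e\<^sub>3 =
     {\<xi> \<in> left_invariant_fields A. \<forall>X\<in>vector_fields A. \<forall>Y\<in>vector_fields A.
        lie_derivative2 \<xi> (sym_ricci g e\<^sub>1 e\<^sub>2 e\<^sub>3 (kobayashi_nomizu D J)) X Y = 0}"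

end

theory Submission
  imports Defs
begin

text \<open>
  Left translations preserve smooth functions, so \<open>T\<^sub>pG\<close> is the image of \<open>T\<^sub>0G\<close> and a tangent vector
  orthogonal to the frame \<open>e\<^sub>1, e\<^sub>2, e\<^sub>3\<close> vanishes; hence every vector field \<open>X\<close> is a combination of the
  frame with the smooth coefficients \<open>\<plusminus>g(X, e\<^sub>i)\<close>, and the left-invariant ones are exactly the
  combinations with constant coefficients. Compatibility with the metric and vanishing torsion
  determine the Levi-Civita connection on the frame, and with it \<open>\<nabla>\<^sup>1\<close> and its Ricci tensor. Since the
  Lie derivative of the symmetrized Ricci tensor is bilinear over smooth functions, its vanishing
  amounts to six polynomial equations in the coefficients of \<open>\<xi>\<close>. They are solved by a case
  distinction; the only delicate case is \<open>\<gamma> = 0\<close> and \<open>\<alpha>, \<beta>, \<delta> \<noteq> 0\<close>, where a nonzero solution is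
  excluded by a sign argument for \<open>\<delta>/\<alpha>\<close>.
\<close>

section \<open>Calculus of \<open>C\<^sup>k\<close> maps\<close>

text \<open>Derivatives in \<open>Ck_on\<close> are full derivatives \<open>at x\<close>; openness
  of \<open>S\<close> makes them depend only on the values on \<open>S\<close>. The later closure
  lemmas use this to replace the chosen \<open>frechet_derivative\<close> by an explicit
  formula.\<close>

lemma Ck_on_cong:
  assumes "open S" and "\<And>x. x \<in> S \<Longrightarrow> f x = g x" and "Ck_on k f S"
  shows "Ck_on k g S"
  using assms(2,3)
proof (induction k arbitrary: f g)
  case 0
  then show ?case by (simp cong: continuous_on_cong)
next
  case (Suc k)
  have "g differentiable (at x)" if "x \<in> S" for x
    using Suc.prems that assms(1)
    by (auto simp: differentiable_def) (metis has_derivative_transform_within_open)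
  moreover have "Ck_on k (\<lambda>x. frechet_derivative g (at x) i) S" if "i \<in> Basis" for i
  proof (rule Suc.IH)
    show "Ck_on k (\<lambda>x. frechet_derivative f (at x) i) S"
      using Suc.prems that by simp
    show "frechet_derivative f (at x) i = frechet_derivative g (at x) i" if "x \<in> S" for x
      using frechet_derivative_transform_within_open[of f x S g] Suc.prems that assms(1) by simp
  qed
  ultimately show ?case by simp
qed

text \<open>Every clause of \<open>Ck_on\<close> concerns arbitrarily small neighbourhoods of single
  points. This allows a map to be studied in charts chosen separately around each point.\<close>

lemma Ck_on_local:
  assumes "\<And>x. x \<in> S \<Longrightarrow> \<exists>T. open T \<and> x \<in> T \<and> Ck_on k f T"
  shows "Ck_on k f S"
  using assms
proof (induction k arbitrary: f)
  case 0
  then show ?case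
    by (metis Ck_on.simps(1) continuous_at_imp_continuous_on continuous_on_eq_continuous_at)
next
  case (Suc k)
  then show ?case
    by (fastforce intro!: Suc.IH)
qed

text \<open>The base case is that differentiability implies continuity. The product and chain rules
  rely on this, since they keep one factor undifferentiated while the order drops by one.\<close>

lemma Ck_on_SucD: "Ck_on (Suc k) f S \<Longrightarrow> Ck_on k f S"
proof (induction k arbitrary: f)
  case 0
  then show ?case
    by (auto intro!: continuous_at_imp_continuous_on differentiable_imp_continuous_within)
next
  case (Suc k)
  then show ?case
    by (subst Ck_on.simps(2)) (auto simp del: Ck_on.simps(2) dest: Ck_on.simps(2)[THEN iffD1])
qed

lemma Ck_on_const [simp]: "Ck_on k (\<lambda>_. c) S"
  by (induction k arbitrary: c) (simp_all add: frechet_derivative_const)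

lemma Ck_on_ident [simp]: "Ck_on k (\<lambda>x. x) S"
  by (cases k) (simp_all add: frechet_derivative_ident)

lemma Ck_on_bounded_linear:
  assumes "bounded_linear L" "open S" "Ck_on k f S"
  shows "Ck_on k (\<lambda>x. L (f x)) S"
  using assms(3)
proof (induction k arbitrary: f)
  case 0
  then show ?case
    by (simp add: bounded_linear.continuous_on[OF assms(1)])
next
  case (Suc k)
  have der: "((\<lambda>x. L (f x)) has_derivative (\<lambda>i. L (frechet_derivative f (at x) i))) (at x)"
    if "x \<in> S" for x
    using Suc.prems that
    by (auto intro!: bounded_linear.has_derivative[OF assms(1)] simp: frechet_derivative_works[symmetric])
  have "Ck_on k (\<lambda>x. frechet_derivative (\<lambda>x. L (f x)) (at x) i) S" if "i \<in> Basis" for i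
    by (rule Ck_on_cong[OF \<open>open S\<close> _ Suc.IH, of "\<lambda>x. frechet_derivative f (at x) i"])
      (use Suc.prems that frechet_derivative_at[OF der] in \<open>auto simp: fun_eq_iff\<close>)
  with der show ?case by (auto simp: differentiable_def)
qed

lemma Ck_on_add:
  assumes "open S" "Ck_on k f S" "Ck_on k g S"
  shows "Ck_on k (\<lambda>x. f x + g x) S"
  using assms(2,3)
proof (induction k arbitrary: f g)
  case 0
  then show ?case by (simp add: continuous_on_add)
next
  case (Suc k)
  have der: "((\<lambda>x. f x + g x) has_derivative
      (\<lambda>i. frechet_derivative f (at x) i + frechet_derivative g (at x) i)) (at x)"
    if "x \<in> S" for x
    using Suc.prems that
    by (auto intro!: has_derivative_add simp: frechet_derivative_works[symmetric])
  have "Ck_on k (\<lambda>x. frechet_derivative (\<lambda>x. f x + g x) (at x) i) S" if "i \<in> Basis" for i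
    by (rule Ck_on_cong[OF \<open>open S\<close> _ Suc.IH, of "\<lambda>x. frechet_derivative f (at x) i" 
          "\<lambda>x. frechet_derivative g (at x) i"])
      (use Suc.prems that frechet_derivative_at[OF der] in \<open>auto simp: fun_eq_iff\<close>)
  with der show ?case by (auto simp: differentiable_def)
qed

lemma Ck_on_sum:
  assumes "open S" "\<And>i. i \<in> I \<Longrightarrow> Ck_on k (f i) S"
  shows "Ck_on k (\<lambda>x. \<Sum>i\<in>I. f i x) S"
  using assms(2)
  by (induction I rule: infinite_finite_induct) (auto intro: Ck_on_add[OF assms(1)])

text \<open>Leibniz rule and induction on the order. Stating it for any bounded bilinear map covers
  both the product of real functions and the scalar multiplication that occurs in the chain
  rule.\<close>

lemma Ck_on_bilinear:
  assumes bil: "bounded_bilinear pr" and "open S" "Ck_on k f S" "Ck_on k g S"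
  shows "Ck_on k (\<lambda>x. pr (f x) (g x)) S"
  using assms(3,4)
proof (induction k arbitrary: f g)
  case 0
  then show ?case by (simp add: bounded_bilinear.continuous_on[OF bil])
next
  case (Suc k)
  have der: "((\<lambda>x. pr (f x) (g x)) has_derivative
      (\<lambda>i. pr (f x) (frechet_derivative g (at x) i) + pr (frechet_derivative f (at x) i) (g x))) (at x)"
    if "x \<in> S" for x
    using Suc.prems that
    by (auto intro!: bounded_bilinear.FDERIV[OF bil] simp: frechet_derivative_works[symmetric])
  have "Ck_on k (\<lambda>x. frechet_derivative (\<lambda>x. pr (f x) (g x)) (at x) i) S" if "i \<in> Basis" for i
    by (rule Ck_on_cong[OF \<open>open S\<close> _ Ck_on_add[OF \<open>open S\<close> Suc.IH Suc.IH], 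
          of f "\<lambda>x. frechet_derivative g (at x) i" "\<lambda>x. frechet_derivative f (at x) i" g])
      (use Suc.prems[THEN Ck_on_SucD] Suc.prems that frechet_derivative_at[OF der] 
        in \<open>auto simp: fun_eq_iff\<close>)
  with der show ?case by (auto simp: differentiable_def)
qed

text \<open>By the chain rule a partial derivative of the composite is a sum of products of partial
  derivatives of \<open>g\<close> with partial derivatives of \<open>f\<close> taken at
  \<open>g x\<close>; the induction hypothesis applies to the latter because only \<open>f\<close>
  is generalised.\<close>

lemma Ck_on_compose:
  fixes f :: "'b::euclidean_space \<Rightarrow> 'c::real_normed_vector"
    and g :: "'a::euclidean_space \<Rightarrow> 'b"
  assumes "open S" "Ck_on k f T" "Ck_on k g S" "g ` S \<subseteq> T"
  shows "Ck_on k (\<lambda>x. f (g x)) S"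
  using assms(2,3)
proof (induction k arbitrary: f)
  case 0
  then show ?case
    using assms(4) by (auto intro: continuous_on_compose2)
next
  case (Suc k)
  have der: "((\<lambda>x. f (g x)) has_derivative
      (\<lambda>i. frechet_derivative f (at (g x)) (frechet_derivative g (at x) i))) (at x)"
    if "x \<in> S" for x
    using Suc.prems that assms(4)
    by (intro has_derivative_compose[of g _ x UNIV f])
      (auto simp: frechet_derivative_works[symmetric])
  \<comment> \<open>\<open>Ck_on\<close> controls derivatives along basis vectors only, whereas the
    chain rule evaluates the derivative of \<open>f\<close> in the direction of a derivative of
    \<open>g\<close>.\<close>
  have expand: "frechet_derivative f (at (g x)) v =
      (\<Sum>j\<in>Basis. (v \<bullet> j) *\<^sub>R frechet_derivative f (at (g x)) j)" if "x \<in> S" for x v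
  proof -
    have lin: "linear (frechet_derivative f (at (g x)))"
      using Suc.prems that assms(4) by (intro linear_frechet_derivative) auto
    show ?thesis
      by (subst euclidean_representation[of v, symmetric])
        (simp add: linear_sum[OF lin] linear_scale[OF lin])
  qed
  have "Ck_on k (\<lambda>x. frechet_derivative (\<lambda>x. f (g x)) (at x) i) S" if i: "i \<in> Basis" for i
  proof (rule Ck_on_cong[OF \<open>open S\<close>])
    show "(\<Sum>j\<in>Basis. (frechet_derivative g (at x) i \<bullet> j) *\<^sub>R frechet_derivative f (at (g x)) j)
        = frechet_derivative (\<lambda>x. f (g x)) (at x) i" if "x \<in> S" for x
      using frechet_derivative_at[OF der[OF that]] expand[OF that]
      by (metis (no_types, lifting) sum.cong)
    show "Ck_on k (\<lambda>x. \<Sum>j\<in>Basis. (frechet_derivative g (at x) i \<bullet> j) *\<^sub>R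
        frechet_derivative f (at (g x)) j) S"
      using Suc.prems i Suc.prems(2)[THEN Ck_on_SucD]
      by (intro Ck_on_sum Ck_on_bilinear[OF bounded_bilinear_scaleR] Suc.IH \<open>open S\<close>
          Ck_on_bounded_linear[OF bounded_linear_inner_left]) auto
  qed
  with der show ?case by (auto simp: differentiable_def)
qed


section \<open>Smooth functions and vector fields\<close>

locale smooth_space =
  fixes A :: "('g::topological_space) atlas"
  assumes atlas: "smooth_atlas A"
begin

lemma open_chart: "(U, \<phi>) \<in> A \<Longrightarrow> open (\<phi> ` U)"
  using atlas by (auto simp: smooth_atlas_def)

lemma smooth_const [simp]: "(\<lambda>_. c) \<in> smooth_functions A"
  by (auto simp: smooth_functions_def Cinf_on_def o_def)

lemma smooth_zero [simp]: "0 \<in> smooth_functions A"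
  using smooth_const[of 0] by (simp add: zero_fun_def)

lemma smooth_add [simp]:
  "f \<in> smooth_functions A \<Longrightarrow> h \<in> smooth_functions A \<Longrightarrow> f + h \<in> smooth_functions A"
  by (fastforce simp: smooth_functions_def Cinf_on_def o_def intro!: Ck_on_add open_chart)

lemma smooth_mult [simp]:
  "f \<in> smooth_functions A \<Longrightarrow> h \<in> smooth_functions A \<Longrightarrow> f * h \<in> smooth_functions A"
  by (fastforce simp: smooth_functions_def Cinf_on_def o_def
      intro!: Ck_on_bilinear[OF bounded_bilinear_mult] open_chart)

lemma smooth_scaleR [simp]: "f \<in> smooth_functions A \<Longrightarrow> c *\<^sub>R f \<in> smooth_functions A"
  using smooth_mult[OF smooth_const[of c], of f]
  by (simp add: times_fun_def scaleR_fun_def)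

lemma smooth_uminus [simp]: "f \<in> smooth_functions A \<Longrightarrow> - f \<in> smooth_functions A"
  using smooth_scaleR[of f "-1"] by simp

lemma smooth_diff [simp]:
  "f \<in> smooth_functions A \<Longrightarrow> h \<in> smooth_functions A \<Longrightarrow> f - h \<in> smooth_functions A"
  using smooth_add[of f "- h"] by simp

end

text \<open>\<open>lie_group\<close> asserts smoothness of addition as a map of two variables; left
  translation is its restriction to the slice where the first variable is \<open>a\<close>, read in
  charts.\<close>

lemma smooth_left_translation:
  assumes lie: "lie_group A" and f: "f \<in> smooth_functions A"
  shows "(\<lambda>x. f (a + x)) \<in> smooth_functions A"
proof -
  have atlas: "smooth_atlas A"
    using lie by (simp add: lie_group_def)
  have "x \<in> (\<Union>(U, \<phi>)\<in>A. U)" for x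
    using atlas by (simp add: smooth_atlas_def)
  then have cover: "\<exists>U \<phi>. (U, \<phi>) \<in> A \<and> x \<in> U" for x
    by fastforce
  have chart: "open U" "open (\<phi> ` U)" "homeomorphism U (\<phi> ` U) \<phi> (inv_into U \<phi>)"
    if "(U, \<phi>) \<in> A" for U \<phi>
    using atlas that by (auto simp: smooth_atlas_def)
  have inv: "inv_into U \<phi> (\<phi> x) = x" if "(U, \<phi>) \<in> A" "x \<in> U" for U \<phi> x
    using homeomorphism_apply1[OF chart(3)] that by blast
  have "Ck_on k ((\<lambda>x. f (a + x)) \<circ> inv_into V \<psi>) (\<psi> ` V)" if V: "(V, \<psi>) \<in> A" for V \<psi> k
  proof (rule Ck_on_local)
    fix y assume "y \<in> \<psi> ` V"
    then obtain x where x: "x \<in> V" "y = \<psi> x" by blast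
    obtain U \<phi> where U: "(U, \<phi>) \<in> A" "a \<in> U" using cover by blast
    obtain W \<theta> where W: "(W, \<theta>) \<in> A" "a + x \<in> W" using cover by blast
    \<comment> \<open>The part of the chart on which the translated point stays inside the single
      chart \<open>W\<close>, so that one coordinate expression of the addition is valid
      there.\<close>
    define T where "T = (\<psi> ` V) \<inter> (\<lambda>b. a + inv_into V \<psi> b) -` W"
    have "continuous_on (\<psi> ` V) (inv_into V \<psi>)"
      using homeomorphism_cont2[OF chart(3)[OF V]] .
    then have "open T"
      unfolding T_def using chart(2)[OF V] chart(1)[OF W(1)]
      by (intro continuous_open_preimage continuous_intros)
    moreover have "y \<in> T"
      using x V W inv by (auto simp: T_def)
    moreover have "Ck_on k ((\<lambda>x. f (a + x)) \<circ> inv_into V \<psi>) T"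
    proof (rule Ck_on_cong[OF \<open>open T\<close>])
      define M where "M = (\<lambda>(a, b). \<theta> (inv_into U \<phi> a + inv_into V \<psi> b))"
      have M: "Ck_on k M {(\<phi> x, \<psi> y) |x y. x \<in> U \<and> y \<in> V \<and> x + y \<in> W}"
        using lie U(1) V W(1) by (fastforce simp: lie_group_def Cinf_on_def M_def)
      \<comment> \<open>The inclusion of the slice is a constant plus a bounded linear map, hence of
        class C^k.\<close>
      have "bounded_linear (\<lambda>b::real^3. (0::real^3, b))"
        by (intro bounded_linear_Pair bounded_linear_zero bounded_linear_ident)
      then have "Ck_on k (\<lambda>b. (\<phi> a, 0) + (0, b)) T"
        by (intro Ck_on_add[OF \<open>open T\<close>] Ck_on_const Ck_on_bounded_linear[OF _ \<open>open T\<close> Ck_on_ident])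
      then have "Ck_on k (\<lambda>b. (\<phi> a, b)) T" by simp
      moreover have "(\<lambda>b. (\<phi> a, b)) ` T \<subseteq> {(\<phi> x, \<psi> y) |x y. x \<in> U \<and> y \<in> V \<and> x + y \<in> W}"
      proof -
        have "\<exists>x y. \<phi> a = \<phi> x \<and> b = \<psi> y \<and> x \<in> U \<and> y \<in> V \<and> x + y \<in> W" if "b \<in> T" for b
          using that U(2) inv[OF V]
          by (intro exI[of _ a] exI[of _ "inv_into V \<psi> b"]) (auto simp: T_def)
        then show ?thesis by blast
      qed
      moreover have "Ck_on k (f \<circ> inv_into W \<theta>) (\<theta> ` W)"
        using f W(1) by (auto simp: smooth_functions_def Cinf_on_def)
      ultimately show "Ck_on k (\<lambda>b. (f \<circ> inv_into W \<theta>) (M (\<phi> a, b))) T"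
        using U V inv
        by (intro Ck_on_compose[OF \<open>open T\<close>, of _ "f \<circ> inv_into W \<theta>" "\<theta> ` W"]
            Ck_on_compose[OF \<open>open T\<close> M]) (auto simp: T_def M_def)
      show "(f \<circ> inv_into W \<theta>) (M (\<phi> a, b)) = ((\<lambda>x. f (a + x)) \<circ> inv_into V \<psi>) b"
        if "b \<in> T" for b
        using that U W(1) inv by (auto simp: T_def M_def)
    qed
    ultimately show "\<exists>T. open T \<and> y \<in> T \<and> Ck_on k ((\<lambda>x. f (a + x)) \<circ> inv_into V \<psi>) T"
      by blast
  qed
  then show ?thesis
    by (auto simp: smooth_functions_def Cinf_on_def)
qed

section \<open>Pointwise identities for vector fields\<close>

lemmas vfield_ext = fun_eq_iff fmult_def scaleR_fun_def

lemma fmult_add: "fmult h (X + Y) = fmult h X + fmult h Y"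
  and fmult_diff: "fmult h (X - Y) = fmult h X - fmult h Y"
  and fmult_uminus: "fmult h (- X) = - fmult h X"
  and fmult_scaleR: "fmult h (c *\<^sub>R X) = c *\<^sub>R fmult h X"
  and fmult_zero: "fmult 0 X = 0"
  and fmult_const: "fmult (\<lambda>_. c) X = c *\<^sub>R X"
  by (simp_all add: vfield_ext algebra_simps)

lemma value_at_add: "value_at (X + Y) p = value_at X p + value_at Y p"
  and value_at_scaleR: "value_at (c *\<^sub>R X) p = c *\<^sub>R value_at X p"
  and value_at_fmult: "value_at (fmult h X) p = h p *\<^sub>R value_at X p"
  by (simp_all add: vfield_ext value_at_def)

lemma vfield_eqI: "(\<And>p. value_at X p = value_at Y p) \<Longrightarrow> X = Y"
  by (simp add: value_at_def fun_eq_iff)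

lemma lie_bracket_anticomm: "lie_bracket X Y = - lie_bracket Y X"
  by (simp add: lie_bracket_def fun_eq_iff)

context smooth_space
begin

text \<open>Outside the algebra of smooth functions a field takes the value 0, which is smooth; so
  the rule holds for arbitrary \<open>f\<close>.\<close>

lemma vf_smooth [simp]: "X \<in> vector_fields A \<Longrightarrow> X f \<in> smooth_functions A"
  unfolding vector_fields_def using smooth_zero by (cases "f \<in> smooth_functions A") auto

lemma vf_outside: "X \<in> vector_fields A \<Longrightarrow> f \<notin> smooth_functions A \<Longrightarrow> X f = 0"
  and vf_apply_add: "X \<in> vector_fields A \<Longrightarrow> f \<in> smooth_functions A \<Longrightarrow> h \<in> smooth_functions A
    \<Longrightarrow> X (f + h) = X f + X h"
  and vf_apply_scaleR: "X \<in> vector_fields A \<Longrightarrow> f \<in> smooth_functions A \<Longrightarrow> X (c *\<^sub>R f) = c *\<^sub>R X f"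
  and vf_apply_mult: "X \<in> vector_fields A \<Longrightarrow> f \<in> smooth_functions A \<Longrightarrow> h \<in> smooth_functions A
    \<Longrightarrow> X (f * h) = X f * h + f * X h"
  unfolding vector_fields_def by blast+

lemma vector_fieldI:
  assumes "\<And>f. f \<notin> smooth_functions A \<Longrightarrow> X f = 0"
    and "\<And>f. f \<in> smooth_functions A \<Longrightarrow> X f \<in> smooth_functions A"
    and "\<And>f h. f \<in> smooth_functions A \<Longrightarrow> h \<in> smooth_functions A \<Longrightarrow> X (f + h) = X f + X h"
    and "\<And>c f. f \<in> smooth_functions A \<Longrightarrow> X (c *\<^sub>R f) = c *\<^sub>R X f"
    and "\<And>f h. f \<in> smooth_functions A \<Longrightarrow> h \<in> smooth_functions A \<Longrightarrow> X (f * h) = X f * h + f * X h"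
  shows "X \<in> vector_fields A"
  unfolding vector_fields_def using assms by blast

lemmas vf_apply = vf_outside vf_apply_add vf_apply_scaleR vf_apply_mult

lemma vf_apply_uminus: "X \<in> vector_fields A \<Longrightarrow> f \<in> smooth_functions A \<Longrightarrow> X (- f) = - X f"
  using vf_apply_scaleR[of X f "-1"] by simp

text \<open>Since 1 = 1 * 1, the Leibniz rule gives X 1 = 2 X 1, so X 1 = 0; homogeneity extends
  this to all constants.\<close>

lemma vf_apply_const :
  assumes "X \<in> vector_fields A"
  shows "X (\<lambda>_. c) = 0"
proof -
  have one: "(\<lambda>_. 1) = (1 :: 'a \<Rightarrow> real)"
    by (simp add: fun_eq_iff)
  have "X 1 = X 1 * 1 + 1 * X 1"
    using vf_apply_mult[OF assms smooth_const[of 1] smooth_const[of 1]] unfolding one by simp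
  then have "X 1 = 0" by simp
  moreover have "(\<lambda>_. c) = c *\<^sub>R (1 :: 'a \<Rightarrow> real)"
    by (simp add: fun_eq_iff scaleR_fun_def)
  ultimately show ?thesis
    using vf_apply_scaleR[OF assms smooth_const[of 1], of c] unfolding one
    by (metis scale_zero_right)
qed

lemma vf_apply_zero [simp]: "X \<in> vector_fields A \<Longrightarrow> X 0 = 0"
  using vf_apply_const[of X 0] unfolding zero_fun_def by simp

lemma vf_add [simp]:
  "X \<in> vector_fields A \<Longrightarrow> Y \<in> vector_fields A \<Longrightarrow> X + Y \<in> vector_fields A"
  by (rule vector_fieldI)
    (simp_all add: vf_apply, simp_all add: fun_eq_iff scaleR_fun_def algebra_simps)

lemma vf_fmult [simp]:
  "h \<in> smooth_functions A \<Longrightarrow> X \<in> vector_fields A \<Longrightarrow> fmult h X \<in> vector_fields A"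
  by (rule vector_fieldI)
    (simp_all add: vf_apply fmult_def, simp_all add: fun_eq_iff scaleR_fun_def algebra_simps)

lemma vf_scaleR [simp]: "X \<in> vector_fields A \<Longrightarrow> c *\<^sub>R X \<in> vector_fields A"
  using vf_fmult[OF smooth_const[of c], of X] by (simp add: fmult_const)

lemma vf_uminus [simp]: "X \<in> vector_fields A \<Longrightarrow> - X \<in> vector_fields A"
  using vf_scaleR[of X "-1"] by simp

lemma vf_diff [simp]:
  "X \<in> vector_fields A \<Longrightarrow> Y \<in> vector_fields A \<Longrightarrow> X - Y \<in> vector_fields A"
  using vf_add[of X "- Y"] by simp

text \<open>In the Leibniz rule the mixed products of first derivatives cancel. The first
  simplification stays at the level of functions, where the derivation rules match; the second is
  pointwise algebra.\<close>

lemma vf_lie_bracket [simp]: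
  assumes "X \<in> vector_fields A" "Y \<in> vector_fields A"
  shows "lie_bracket X Y \<in> vector_fields A"
  unfolding lie_bracket_def
  by (rule vector_fieldI)
    (use assms in \<open>simp_all only: vf_apply vf_apply_zero vf_smooth smooth_add
      smooth_mult smooth_scaleR smooth_diff simp_thms diff_self\<close>,
     simp_all add: fun_eq_iff scaleR_fun_def algebra_simps)

lemma value_at_tangent [simp]: "X \<in> vector_fields A \<Longrightarrow> value_at X p \<in> tangent_space A p"
  by (simp add: tangent_space_def value_at_def vf_apply)
    (simp add: scaleR_fun_def)

lemma lie_bracket_add_left:
  assumes "X \<in> vector_fields A" "X' \<in> vector_fields A" "Y \<in> vector_fields A"
  shows "lie_bracket (X + X') Y = lie_bracket X Y + lie_bracket X' Y"
  using assms by (simp add: fun_eq_iff lie_bracket_def vf_apply_add)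

lemma lie_bracket_fmult_left:
  assumes "X \<in> vector_fields A" "Y \<in> vector_fields A" "h \<in> smooth_functions A"
  shows "lie_bracket (fmult h X) Y = fmult h (lie_bracket X Y) - fmult (Y h) X"
  using assms by (simp add: fun_eq_iff lie_bracket_def fmult_def vf_apply_mult algebra_simps)

lemma lie_bracket_scaleR_left:
  assumes "X \<in> vector_fields A" "Y \<in> vector_fields A"
  shows "lie_bracket (c *\<^sub>R X) Y = c *\<^sub>R lie_bracket X Y"
  using lie_bracket_fmult_left[OF assms smooth_const[of c]] assms
  by (simp add: vf_apply_const fmult_const fmult_zero)

lemma lie_bracket_add_right:
  assumes "X \<in> vector_fields A" "X' \<in> vector_fields A" "Y \<in> vector_fields A"
  shows "lie_bracket Y (X + X') = lie_bracket Y X + lie_bracket Y X'"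
  using lie_bracket_add_left[OF assms] 
  by (simp add: lie_bracket_anticomm[of Y])

lemma lie_bracket_fmult_right:
  assumes "X \<in> vector_fields A" "Y \<in> vector_fields A" "h \<in> smooth_functions A"
  shows "lie_bracket Y (fmult h X) = fmult h (lie_bracket Y X) + fmult (Y h) X"
  using lie_bracket_fmult_left[OF assms] 
  by (simp add: lie_bracket_anticomm[of Y] fmult_uminus)

lemma lie_bracket_scaleR_right:
  assumes "X \<in> vector_fields A" "Y \<in> vector_fields A"
  shows "lie_bracket Y (c *\<^sub>R X) = c *\<^sub>R lie_bracket Y X"
  using lie_bracket_scaleR_left[OF assms] 
  by (simp add: lie_bracket_anticomm[of Y])

end


section \<open>Affine connections and curvature\<close>

text \<open>Used twice: for the Levi-Civita connection, and for the Kobayashi-Nomizu connection,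
  whose curvature enters the Ricci tensor.\<close>

locale connection_space = smooth_space A for A :: "('g::topological_space) atlas" +
  fixes D :: "'g connection"
  assumes connection: "affine_connection A D"
begin

lemma vf_conn [simp]:
  "X \<in> vector_fields A \<Longrightarrow> Y \<in> vector_fields A \<Longrightarrow> D X Y \<in> vector_fields A"
  using connection by (simp add: affine_connection_def)

lemma conn_add_left:
  "X \<in> vector_fields A \<Longrightarrow> X' \<in> vector_fields A \<Longrightarrow> Y \<in> vector_fields A
    \<Longrightarrow> D (X + X') Y = D X Y + D X' Y"
  using connection by (simp add: affine_connection_def)

lemma conn_add_right:
  "X \<in> vector_fields A \<Longrightarrow> Y \<in> vector_fields A \<Longrightarrow> Y' \<in> vector_fields A
    \<Longrightarrow> D X (Y + Y') = D X Y + D X Y'"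
  using connection by (simp add: affine_connection_def)

lemma conn_fmult_left:
  "h \<in> smooth_functions A \<Longrightarrow> X \<in> vector_fields A \<Longrightarrow> Y \<in> vector_fields A
    \<Longrightarrow> D (fmult h X) Y = fmult h (D X Y)"
  using connection by (simp add: affine_connection_def)

lemma conn_fmult_right:
  "h \<in> smooth_functions A \<Longrightarrow> X \<in> vector_fields A \<Longrightarrow> Y \<in> vector_fields A
    \<Longrightarrow> D X (fmult h Y) = fmult (X h) Y + fmult h (D X Y)"
  using connection by (simp add: affine_connection_def)

lemma conn_scaleR_left:
  "X \<in> vector_fields A \<Longrightarrow> Y \<in> vector_fields A \<Longrightarrow> D (c *\<^sub>R X) Y = c *\<^sub>R D X Y"
  using conn_fmult_left[OF smooth_const[of c]] by (simp add: fmult_const)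

lemma conn_scaleR_right:
  "X \<in> vector_fields A \<Longrightarrow> Y \<in> vector_fields A \<Longrightarrow> D X (c *\<^sub>R Y) = c *\<^sub>R D X Y"
  using conn_fmult_right[OF smooth_const[of c]] by (simp add: vf_apply_const fmult_const fmult_zero)

lemma conn_uminus_left:
  "X \<in> vector_fields A \<Longrightarrow> Y \<in> vector_fields A \<Longrightarrow> D (- X) Y = - D X Y"
  using conn_scaleR_left[of X Y "-1"] by simp

lemma conn_diff_left:
  "X \<in> vector_fields A \<Longrightarrow> X' \<in> vector_fields A \<Longrightarrow> Y \<in> vector_fields A
    \<Longrightarrow> D (X - X') Y = D X Y - D X' Y"
  using conn_add_left[of X "- X'" Y] by (simp add: conn_uminus_left)

section \<open>Tensoriality of the curvature\<close>

lemma vf_curvature [simp]: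
  "X \<in> vector_fields A \<Longrightarrow> Y \<in> vector_fields A \<Longrightarrow> Z \<in> vector_fields A
    \<Longrightarrow> curvature D X Y Z \<in> vector_fields A"
  by (simp add: curvature_def)

lemma curvature_add_1:
  assumes "X \<in> vector_fields A" "X' \<in> vector_fields A" "Y \<in> vector_fields A" "Z \<in> vector_fields A"
  shows "curvature D (X + X') Y Z = curvature D X Y Z + curvature D X' Y Z"
  using assms
  by (simp add: curvature_def lie_bracket_add_left conn_add_left conn_add_right)

lemma curvature_add_3:
  assumes "X \<in> vector_fields A" "Y \<in> vector_fields A" "Z \<in> vector_fields A" "Z' \<in> vector_fields A"
  shows "curvature D X Y (Z + Z') = curvature D X Y Z + curvature D X Y Z'"
  using assms by (simp add: curvature_def conn_add_right)

text \<open>The term with Y h produced by differentiating h D X Z cancels the one coming from the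
  bracket of h X and Y.\<close>

lemma curvature_fmult_1:
  assumes "X \<in> vector_fields A" "Y \<in> vector_fields A" "Z \<in> vector_fields A" "h \<in> smooth_functions A"
  shows "curvature D (fmult h X) Y Z = fmult h (curvature D X Y Z)"
  using assms
  by (simp add: curvature_def lie_bracket_fmult_left conn_fmult_left conn_fmult_right
      conn_diff_left fmult_diff)

text \<open>First derivatives of h cancel in pairs, and the second derivatives X (Y h) - Y (X h) are
  absorbed by the bracket term; hence the final unfolding of \<open>lie_bracket\<close>.\<close>

lemma curvature_fmult_3:
  assumes "X \<in> vector_fields A" "Y \<in> vector_fields A" "Z \<in> vector_fields A" "h \<in> smooth_functions A"
  shows "curvature D X Y (fmult h Z) = fmult h (curvature D X Y Z)"
  using assms
  by (simp add: curvature_def conn_add_right conn_fmult_right fmult_diff)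
    (simp add: lie_bracket_def vfield_ext algebra_simps)

end

text \<open>The correction to \<open>D\<close> is built from \<open>nabla_J\<close>, which is linear
  over smooth functions in both arguments. Adding a tensor to a connection yields a
  connection.\<close>

lemma affine_connection_kobayashi_nomizu:
  assumes "smooth_atlas A" and "affine_connection A D" and J: "tensor_field11 A J"
  shows "affine_connection A (kobayashi_nomizu D J)"
proof -
  interpret connection_space A D
    using assms by unfold_locales
  have J_vf [simp]: "tensor_app J X \<in> vector_fields A" if "X \<in> vector_fields A" for X
    using J that by (simp add: tensor_field11_def)
  have J_add: "tensor_app J (X + Y) = tensor_app J X + tensor_app J Y"
    if "X \<in> vector_fields A" "Y \<in> vector_fields A" for X Y
    using J that by (simp add: tensor_field11_def tensor_app_def fun_eq_iff value_at_add)
  have J_fmult: "tensor_app J (fmult h X) = fmult h (tensor_app J X)"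
    if "X \<in> vector_fields A" for h X
  proof -
    have "J p (h p *\<^sub>R value_at X p) = h p *\<^sub>R J p (value_at X p)" for p
      using J value_at_tangent[OF that] unfolding tensor_field11_def by blast
    then show ?thesis
      by (simp only: tensor_app_def value_at_fmult)
        (simp add: fmult_def scaleR_fun_def fun_eq_iff)
  qed
  have [simp]: "nabla_J D J X Y \<in> vector_fields A"
    if "X \<in> vector_fields A" "Y \<in> vector_fields A" for X Y
    using that by (simp add: nabla_J_def)
  have nJ: "nabla_J D J (X + X') Y = nabla_J D J X Y + nabla_J D J X' Y"
    "nabla_J D J Y (X + X') = nabla_J D J Y X + nabla_J D J Y X'"
    if "X \<in> vector_fields A" "X' \<in> vector_fields A" "Y \<in> vector_fields A" for X X' Y
    using that by (simp_all add: nabla_J_def J_add conn_add_left conn_add_right)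
  \<comment> \<open>In the second identity both terms of \<open>nabla_J\<close> contribute the same
    derivative of h times J X, and these cancel.\<close>
  have nJ': "nabla_J D J (fmult h X) Y = fmult h (nabla_J D J X Y)"
    "nabla_J D J Y (fmult h X) = fmult h (nabla_J D J Y X)"
    if "X \<in> vector_fields A" "h \<in> smooth_functions A" "Y \<in> vector_fields A" for X h Y
    using that
    by (simp_all add: nabla_J_def J_add J_fmult conn_fmult_left conn_fmult_right fmult_diff)
  show ?thesis
    unfolding affine_connection_def kobayashi_nomizu_def canonical_connection_def
    by (auto simp: nJ nJ' J_add J_fmult conn_add_left conn_add_right conn_fmult_left
        conn_fmult_right fmult_diff fmult_scaleR scaleR_right_distrib scaleR_right_diff_distrib)
qed


section \<open>Symmetric covariant tensors\<close>

text \<open>Linearity is required in the left argument; symmetry transfers it to the right one.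
  Instances are the symmetrized Ricci tensor and its Lie derivatives.\<close>

definition sym_tensor02 ::
    "('g::topological_space) atlas \<Rightarrow> ('g vfield \<Rightarrow> 'g vfield \<Rightarrow> 'g \<Rightarrow> real) \<Rightarrow> bool" where
  "sym_tensor02 A T \<longleftrightarrow>
     (\<forall>X\<in>vector_fields A. \<forall>Y\<in>vector_fields A. T X Y \<in> smooth_functions A \<and> T X Y = T Y X) \<and>
     (\<forall>X\<in>vector_fields A. \<forall>X'\<in>vector_fields A. \<forall>Y\<in>vector_fields A. T (X + X') Y = T X Y + T X' Y) \<and>
     (\<forall>h\<in>smooth_functions A. \<forall>X\<in>vector_fields A. \<forall>Y\<in>vector_fields A. T (fmult h X) Y = h * T X Y)"

context smooth_space
begin

lemma sym_tensor02_smooth [simp]: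
  "sym_tensor02 A T \<Longrightarrow> X \<in> vector_fields A \<Longrightarrow> Y \<in> vector_fields A \<Longrightarrow> T X Y \<in> smooth_functions A"
  unfolding sym_tensor02_def by blast

lemma sym_tensor02_commute:
  "sym_tensor02 A T \<Longrightarrow> X \<in> vector_fields A \<Longrightarrow> Y \<in> vector_fields A \<Longrightarrow> T X Y = T Y X"
  unfolding sym_tensor02_def by blast

lemma sym_tensor02_add_left:
  "sym_tensor02 A T \<Longrightarrow> X \<in> vector_fields A \<Longrightarrow> X' \<in> vector_fields A \<Longrightarrow> Y \<in> vector_fields A
    \<Longrightarrow> T (X + X') Y = T X Y + T X' Y"
  unfolding sym_tensor02_def by blast

lemma sym_tensor02_fmult_left:
  "sym_tensor02 A T \<Longrightarrow> h \<in> smooth_functions A \<Longrightarrow> X \<in> vector_fields A \<Longrightarrow> Y \<in> vector_fields A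
    \<Longrightarrow> T (fmult h X) Y = h * T X Y"
  unfolding sym_tensor02_def by blast

lemma sym_tensor02_add_right:
  "sym_tensor02 A T \<Longrightarrow> X \<in> vector_fields A \<Longrightarrow> X' \<in> vector_fields A \<Longrightarrow> Y \<in> vector_fields A
    \<Longrightarrow> T Y (X + X') = T Y X + T Y X'"
  using sym_tensor02_commute[of T "X + X'" Y] sym_tensor02_commute[of T X Y]
    sym_tensor02_commute[of T X' Y] sym_tensor02_add_left[of T X X' Y] by simp

lemma sym_tensor02_fmult_right:
  "sym_tensor02 A T \<Longrightarrow> h \<in> smooth_functions A \<Longrightarrow> X \<in> vector_fields A \<Longrightarrow> Y \<in> vector_fields A
    \<Longrightarrow> T Y (fmult h X) = h * T Y X"
  using sym_tensor02_commute[of T "fmult h X" Y] sym_tensor02_commute[of T X Y]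
    sym_tensor02_fmult_left[of T h X Y] by simp

text \<open>For a multiple h X, the term \<xi>(h) T X Y from differentiating the product cancels the
  one from the bracket of \<xi> with h X.\<close>

lemma sym_tensor02_lie_derivative2:
  assumes "sym_tensor02 A T" and "\<xi> \<in> vector_fields A"
  shows "sym_tensor02 A (lie_derivative2 \<xi> T)"
proof -
  have "lie_derivative2 \<xi> T X Y = lie_derivative2 \<xi> T Y X"
    if "X \<in> vector_fields A" "Y \<in> vector_fields A" for X Y
    using that assms sym_tensor02_commute[of T X Y] sym_tensor02_commute[of T "lie_bracket \<xi> X" Y]
      sym_tensor02_commute[of T X "lie_bracket \<xi> Y"]
    by (simp add: lie_derivative2_def)
  moreover have "lie_derivative2 \<xi> T (X + X') Y = lie_derivative2 \<xi> T X Y + lie_derivative2 \<xi> T X' Y"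
    if "X \<in> vector_fields A" "X' \<in> vector_fields A" "Y \<in> vector_fields A" for X X' Y
    using that assms
    by (simp only: lie_derivative2_def lie_bracket_add_right sym_tensor02_add_left vf_apply_add
        sym_tensor02_smooth vf_lie_bracket) (simp add: fun_eq_iff)
  moreover have "lie_derivative2 \<xi> T (fmult h X) Y = h * lie_derivative2 \<xi> T X Y"
    if "h \<in> smooth_functions A" "X \<in> vector_fields A" "Y \<in> vector_fields A" for h X Y
    using that assms
    by (simp only: lie_derivative2_def lie_bracket_fmult_right sym_tensor02_add_left
        sym_tensor02_fmult_left vf_apply_mult sym_tensor02_smooth vf_lie_bracket vf_fmult vf_smooth)
      (simp add: fun_eq_iff algebra_simps)
  ultimately show ?thesis
    unfolding sym_tensor02_def[of A "lie_derivative2 \<xi> T"]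
    using assms by (auto simp: lie_derivative2_def)
qed

end


section \<open>Lorentzian metrics\<close>

locale lorentzian_space = smooth_space A for A :: "('g::topological_space) atlas" +
  fixes g :: "'g metric"
  assumes lorentzian: "lorentzian_metric A g"
begin

lemma metric_add_left:
  "u \<in> tangent_space A p \<Longrightarrow> v \<in> tangent_space A p \<Longrightarrow> w \<in> tangent_space A p
    \<Longrightarrow> g p (u + v) w = g p u w + g p v w"
  using lorentzian by (simp add: lorentzian_metric_def)

lemma metric_scaleR_left:
  "u \<in> tangent_space A p \<Longrightarrow> w \<in> tangent_space A p \<Longrightarrow> g p (c *\<^sub>R u) w = c * g p u w"
  using lorentzian by (simp add: lorentzian_metric_def)

lemma metric_app_smooth [simp]:
  "X \<in> vector_fields A \<Longrightarrow> Y \<in> vector_fields A \<Longrightarrow> metric_app g X Y \<in> smooth_functions A"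
  using lorentzian by (simp add: lorentzian_metric_def)

lemma metric_app_commute:
  "X \<in> vector_fields A \<Longrightarrow> Y \<in> vector_fields A \<Longrightarrow> metric_app g X Y = metric_app g Y X"
  using lorentzian value_at_tangent unfolding lorentzian_metric_def metric_app_def fun_eq_iff by blast

lemma metric_app_add_left:
  "X \<in> vector_fields A \<Longrightarrow> X' \<in> vector_fields A \<Longrightarrow> Y \<in> vector_fields A
    \<Longrightarrow> metric_app g (X + X') Y = metric_app g X Y + metric_app g X' Y"
  by (simp add: metric_app_def fun_eq_iff value_at_add metric_add_left)

lemma metric_app_fmult_left:
  "X \<in> vector_fields A \<Longrightarrow> Y \<in> vector_fields A
    \<Longrightarrow> metric_app g (fmult h X) Y = h * metric_app g X Y"
  by (simp add: metric_app_def fun_eq_iff value_at_fmult metric_scaleR_left)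

lemma metric_app_scaleR_left:
  "X \<in> vector_fields A \<Longrightarrow> Y \<in> vector_fields A
    \<Longrightarrow> metric_app g (c *\<^sub>R X) Y = c *\<^sub>R metric_app g X Y"
  by (simp add: metric_app_def fun_eq_iff value_at_scaleR metric_scaleR_left)
    (simp add: scaleR_fun_def)

lemma metric_app_uminus_left:
  "X \<in> vector_fields A \<Longrightarrow> Y \<in> vector_fields A
    \<Longrightarrow> metric_app g (- X) Y = - metric_app g X Y"
  using metric_app_scaleR_left[of X Y "-1"] by simp

lemma metric_app_diff_left:
  "X \<in> vector_fields A \<Longrightarrow> X' \<in> vector_fields A \<Longrightarrow> Y \<in> vector_fields A
    \<Longrightarrow> metric_app g (X - X') Y = metric_app g X Y - metric_app g X' Y"
  using metric_app_add_left[of X "- X'" Y] by (simp add: metric_app_uminus_left)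

lemma sym_tensor02_sym_ricci:
  assumes "affine_connection A K"
    and "e\<^sub>1 \<in> vector_fields A" "e\<^sub>2 \<in> vector_fields A" "e\<^sub>3 \<in> vector_fields A"
  shows "sym_tensor02 A (sym_ricci g e\<^sub>1 e\<^sub>2 e\<^sub>3 K)"
proof -
  interpret K: connection_space A K
    by unfold_locales fact
  show ?thesis
    using assms(2-)
    by (auto simp: sym_tensor02_def sym_ricci_def ricci_def K.curvature_add_1 K.curvature_add_3
        K.curvature_fmult_1 K.curvature_fmult_3 metric_app_add_left metric_app_fmult_left
        algebra_simps)
     (simp_all add: fun_eq_iff scaleR_fun_def algebra_simps)
qed

end

section \<open>Pseudo-orthonormal left-invariant frames\<close>

locale lie_frame =
  fixes A :: "('g::{topological_group_add, t2_space, second_countable_topology}) atlas"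
    and g :: "'g metric" and e\<^sub>1 e\<^sub>2 e\<^sub>3 :: "'g vfield"
  assumes lie: "lie_group A"
    and lorentzian_g: "lorentzian_metric A g"
    and left_invariant_g: "left_invariant_metric A g"
    and basis: "lie_algebra_basis A e\<^sub>1 e\<^sub>2 e\<^sub>3"
    and orthonormal: "pseudo_orthonormal g e\<^sub>1 e\<^sub>2 e\<^sub>3"

sublocale lie_frame \<subseteq> lorentzian_space A g
  using lie lorentzian_g by unfold_locales (simp_all add: lie_group_def)

context lie_frame
begin

text \<open>Normal form for left-invariant fields: brackets, \<open>J\<close> and connections all
  become polynomial operations on coefficient triples.\<close>

definition comb :: "real \<Rightarrow> real \<Rightarrow> real \<Rightarrow> 'g vfield" where
  "comb x y z = x *\<^sub>R e\<^sub>1 + y *\<^sub>R e\<^sub>2 + z *\<^sub>R e\<^sub>3"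

lemma frame_vf [simp]: "e\<^sub>1 \<in> vector_fields A" "e\<^sub>2 \<in> vector_fields A" "e\<^sub>3 \<in> vector_fields A"
  using basis by (auto simp: lie_algebra_basis_def left_invariant_fields_def)

lemma frame_left_invariant:
  "value_at e\<^sub>1 (a + p) = dL a (value_at e\<^sub>1 p)"
  "value_at e\<^sub>2 (a + p) = dL a (value_at e\<^sub>2 p)"
  "value_at e\<^sub>3 (a + p) = dL a (value_at e\<^sub>3 p)"
  using basis by (auto simp: lie_algebra_basis_def left_invariant_fields_def)

lemma comb_vf [simp]: "comb x y z \<in> vector_fields A"
  by (simp add: comb_def)

lemma comb_unit: "comb 1 0 0 = e\<^sub>1" "comb 0 1 0 = e\<^sub>2" "comb 0 0 1 = e\<^sub>3"
  by (simp_all add: comb_def)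

lemma comb_add: "comb x y z + comb x' y' z' = comb (x + x') (y + y') (z + z')"
  and comb_diff: "comb x y z - comb x' y' z' = comb (x - x') (y - y') (z - z')"
  and comb_uminus: "- comb x y z = comb (- x) (- y) (- z)"
  and comb_scaleR: "c *\<^sub>R comb x y z = comb (c * x) (c * y) (c * z)"
  by (simp_all add: comb_def algebra_simps)

lemmas comb_arith = comb_add comb_diff comb_uminus comb_scaleR

lemma metric_frame:
  "metric_app g e\<^sub>1 e\<^sub>1 = 1" "metric_app g e\<^sub>2 e\<^sub>2 = 1" "metric_app g e\<^sub>3 e\<^sub>3 = - 1"
  "metric_app g e\<^sub>1 e\<^sub>2 = 0" "metric_app g e\<^sub>1 e\<^sub>3 = 0" "metric_app g e\<^sub>2 e\<^sub>3 = 0"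
  "metric_app g e\<^sub>2 e\<^sub>1 = 0" "metric_app g e\<^sub>3 e\<^sub>1 = 0" "metric_app g e\<^sub>3 e\<^sub>2 = 0"
  using orthonormal metric_app_commute[of e\<^sub>1 e\<^sub>2] metric_app_commute[of e\<^sub>1 e\<^sub>3]
    metric_app_commute[of e\<^sub>2 e\<^sub>3]
  by (simp_all add: pseudo_orthonormal_def)

lemma metric_comb_frame:
  "metric_app g (comb x y z) e\<^sub>1 = (\<lambda>_. x)"
  "metric_app g (comb x y z) e\<^sub>2 = (\<lambda>_. y)"
  "metric_app g (comb x y z) e\<^sub>3 = (\<lambda>_. - z)"
  by (simp_all add: comb_def metric_app_add_left metric_app_scaleR_left metric_frame)
    (simp_all add: fun_eq_iff scaleR_fun_def)

text \<open>The metric products with the frame recover the coefficients, the third up to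
  sign.\<close>

lemma comb_eq_iff: "comb x y z = comb x' y' z' \<longleftrightarrow> x = x' \<and> y = y' \<and> z = z'"
  by (metis add.inverse_inverse metric_comb_frame)

lemma dL_tangent:
  assumes v: "v \<in> tangent_space A p"
  shows "dL a v \<in> tangent_space A (a + p)"
proof -
  \<comment> \<open>The equivalence, and not just one direction, is required: a tangent vector must
    vanish on functions that are not smooth. The converse translates by \<open>- a\<close>.\<close>
  have shift: "(\<lambda>x. f (a + x)) \<in> smooth_functions A \<longleftrightarrow> f \<in> smooth_functions A" for f
  proof
    assume "(\<lambda>x. f (a + x)) \<in> smooth_functions A"
    from smooth_left_translation[OF lie this, of "- a"] show "f \<in> smooth_functions A"
      by (simp add: add.assoc[symmetric])
  qed (rule smooth_left_translation[OF lie])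
  have "v (\<lambda>x. (f + h) (a + x)) = v (\<lambda>x. f (a + x)) + v (\<lambda>x. h (a + x))"
    "v (\<lambda>x. (c *\<^sub>R f) (a + x)) = c * v (\<lambda>x. f (a + x))"
    "v (\<lambda>x. (f * h) (a + x)) = v (\<lambda>x. f (a + x)) * h (a + p) + f (a + p) * v (\<lambda>x. h (a + x))"
    if "f \<in> smooth_functions A" "h \<in> smooth_functions A" for f h c
  proof -
    let ?f = "\<lambda>x. f (a + x)" and ?h = "\<lambda>x. h (a + x)"
    have "?f \<in> smooth_functions A" "?h \<in> smooth_functions A"
      using that shift by simp_all
    then have "v (?f + ?h) = v ?f + v ?h" "v (c *\<^sub>R ?f) = c * v ?f"
      "v (?f * ?h) = v ?f * ?h p + ?f p * v ?h"
      using v unfolding tangent_space_def by blast+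
    then show "v (\<lambda>x. (f + h) (a + x)) = v ?f + v ?h"
      "v (\<lambda>x. (c *\<^sub>R f) (a + x)) = c * v ?f"
      "v (\<lambda>x. (f * h) (a + x)) = v ?f * h (a + p) + f (a + p) * v ?h"
      by (simp_all add: plus_fun_def times_fun_def scaleR_fun_def)
  qed
  moreover have "v (\<lambda>x. f (a + x)) = 0" if "f \<notin> smooth_functions A" for f
    using v that shift unfolding tangent_space_def by blast
  ultimately show ?thesis
    unfolding tangent_space_def dL_def mem_Collect_eq by blast
qed

text \<open>The frame is known to span only at the identity. Left invariance of the metric and of
  the frame moves the orthogonality relations there, where orthonormality kills all
  coefficients.\<close>

lemma frame_nondegenerate:
  assumes w: "w \<in> tangent_space A p"
    and ortho: "g p w (value_at e\<^sub>1 p) = 0" "g p w (value_at e\<^sub>2 p) = 0" "g p w (value_at e\<^sub>3 p) = 0"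
  shows "w = 0"
proof -
  define u where "u = dL (- p) w"
  have u: "u \<in> tangent_space A 0"
    using dL_tangent[OF w, of "- p"] by (simp add: u_def)
  have inv: "g (- p + p) (dL (- p) w) (dL (- p) v) = g p w v" if "v \<in> tangent_space A p" for v
    using left_invariant_g w that unfolding left_invariant_metric_def by blast
  have u0: "g 0 u (value_at e\<^sub>1 0) = 0" "g 0 u (value_at e\<^sub>2 0) = 0" "g 0 u (value_at e\<^sub>3 0) = 0"
    using inv[of "value_at e\<^sub>1 p"] inv[of "value_at e\<^sub>2 p"] inv[of "value_at e\<^sub>3 p"] ortho
      frame_left_invariant[of "- p" p] by (simp_all add: u_def)
  have "u \<in> span {value_at e\<^sub>1 0, value_at e\<^sub>2 0, value_at e\<^sub>3 0}"
    using u basis by (simp add: lie_algebra_basis_def)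
  then obtain x y z where "u = value_at (comb x y z) 0"
    by (auto simp: span_insert span_singleton comb_def value_at_add value_at_scaleR algebra_simps
        span_empty)
  with u0 have "comb x y z = 0"
    using fun_cong[OF metric_comb_frame(1), of x y z 0] fun_cong[OF metric_comb_frame(2), of x y z 0]
      fun_cong[OF metric_comb_frame(3), of x y z 0]
    by (simp add: metric_app_def comb_def)
  then have "u = 0"
    using \<open>u = value_at (comb x y z) 0\<close> by (simp add: value_at_def fun_eq_iff)
  \<comment> \<open>Translating back by \<open>p\<close> recovers \<open>w\<close> from
    \<open>u\<close>.\<close>
  have "w f = 0" for f
  proof -
    have "w f = u (\<lambda>x. f (p + x))"
      by (simp add: u_def dL_def add.assoc[symmetric])
    with \<open>u = 0\<close> show ?thesis by simp
  qed
  then show ?thesis by (simp add: fun_eq_iff)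
qed

lemma vfield_eqI_metric:
  assumes X: "X \<in> vector_fields A" and Y: "Y \<in> vector_fields A"
    and "metric_app g X e\<^sub>1 = metric_app g Y e\<^sub>1" "metric_app g X e\<^sub>2 = metric_app g Y e\<^sub>2"
      "metric_app g X e\<^sub>3 = metric_app g Y e\<^sub>3"
  shows "X = Y"
proof -
  have zero: "metric_app g (X - Y) e\<^sub>1 = 0" "metric_app g (X - Y) e\<^sub>2 = 0" "metric_app g (X - Y) e\<^sub>3 = 0"
    using assms by (simp_all add: metric_app_diff_left)
  have "value_at (X - Y) p = 0" for p
    using X Y fun_cong[OF zero(1), of p] fun_cong[OF zero(2), of p] fun_cong[OF zero(3), of p]
    by (intro frame_nondegenerate[of _ p]) (simp_all add: metric_app_def)
  then have "X - Y = 0"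
    by (simp add: value_at_def fun_eq_iff)
  then show ?thesis by simp
qed

lemma comb_eqI:
  assumes "X \<in> vector_fields A"
    and "\<And>p. metric_app g X e\<^sub>1 p = x" "\<And>p. metric_app g X e\<^sub>2 p = y" "\<And>p. metric_app g X e\<^sub>3 p = - z"
  shows "X = comb x y z"
  using assms by (intro vfield_eqI_metric) (simp_all add: metric_comb_frame fun_eq_iff)

text \<open>Both sides have the same products with the frame; the sign in the last term reflects
  that \<open>e\<^sub>3\<close> is timelike.\<close>

lemma frame_expansion:
  assumes X: "X \<in> vector_fields A"
  shows "X = fmult (metric_app g X e\<^sub>1) e\<^sub>1 + fmult (metric_app g X e\<^sub>2) e\<^sub>2
    + fmult (- metric_app g X e\<^sub>3) e\<^sub>3"
  using X by (intro vfield_eqI_metric)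
    (simp_all add: metric_app_add_left metric_app_fmult_left metric_frame)

text \<open>A left-invariant field is determined by its value at the identity, where the frame
  spans.\<close>

lemma left_invariant_fields_eq: "left_invariant_fields A = {comb x y z |x y z. True}"
proof (intro equalityI subsetI)
  fix X assume X: "X \<in> left_invariant_fields A"
  then have vf: "X \<in> vector_fields A" and inv: "value_at X (p + 0) = dL p (value_at X 0)" for p
    unfolding left_invariant_fields_def by blast+
  have "value_at X 0 \<in> span {value_at e\<^sub>1 0, value_at e\<^sub>2 0, value_at e\<^sub>3 0}"
    using vf basis by (simp add: lie_algebra_basis_def)
  then obtain x y z where 0: "value_at X 0 = value_at (comb x y z) 0"
    by (auto simp: span_insert span_singleton comb_def value_at_add value_at_scaleR algebra_simps
        span_empty)
  have "value_at X p = value_at (comb x y z) p" for p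
    using inv[of p] 0 frame_left_invariant[of p 0]
    by (simp add: comb_def value_at_add value_at_scaleR) (simp add: dL_def scaleR_fun_def fun_eq_iff)
  then have "X = comb x y z" by (rule vfield_eqI)
  then show "X \<in> {comb x y z |x y z. True}" by blast
next
  fix X assume "X \<in> {comb x y z |x y z. True}"
  then obtain x y z where "X = comb x y z" by auto
  moreover have "value_at (comb x y z) (a + p) = dL a (value_at (comb x y z) p)" for a p
    by (simp add: comb_def value_at_add value_at_scaleR frame_left_invariant)
      (simp add: dL_def scaleR_fun_def fun_eq_iff)
  ultimately show "X \<in> left_invariant_fields A"
    by (simp add: left_invariant_fields_def)
qed

lemma sym_tensor02_zeroI:
  assumes T: "sym_tensor02 A T"
    and "T e\<^sub>1 e\<^sub>1 = 0" "T e\<^sub>1 e\<^sub>2 = 0" "T e\<^sub>1 e\<^sub>3 = 0" "T e\<^sub>2 e\<^sub>2 = 0" "T e\<^sub>2 e\<^sub>3 = 0" "T e\<^sub>3 e\<^sub>3 = 0"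
    and X: "X \<in> vector_fields A" and Y: "Y \<in> vector_fields A"
  shows "T X Y = 0"
proof -
  have frame: "T e e' = 0" if "e \<in> {e\<^sub>1, e\<^sub>2, e\<^sub>3}" "e' \<in> {e\<^sub>1, e\<^sub>2, e\<^sub>3}" for e e'
    using that assms sym_tensor02_commute[OF T, of e\<^sub>1 e\<^sub>2] sym_tensor02_commute[OF T, of e\<^sub>1 e\<^sub>3]
      sym_tensor02_commute[OF T, of e\<^sub>2 e\<^sub>3] by auto
  \<comment> \<open>Expansion of the left argument in the frame; the right argument follows
    afterwards.\<close>
  have half: "T Z e = 0" if "e \<in> {e\<^sub>1, e\<^sub>2, e\<^sub>3}" "Z \<in> vector_fields A" for Z e
  proof -
    have "e \<in> vector_fields A" using that by auto
    with that T frame show ?thesis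
      by (subst frame_expansion[of Z]) (simp_all add: sym_tensor02_add_left sym_tensor02_fmult_left fun_eq_iff)
  qed
  show ?thesis
    using T X Y half
    by (subst frame_expansion[of Y]) (simp_all add: sym_tensor02_add_right sym_tensor02_fmult_right fun_eq_iff)
qed

end


section \<open>The group \<open>G\<^sub>7\<close>\<close>

locale lie_group_G7 = lie_frame A g e\<^sub>1 e\<^sub>2 e\<^sub>3
  for A :: "('g::{topological_group_add, t2_space, second_countable_topology}) atlas"
    and g :: "'g metric" and e\<^sub>1 e\<^sub>2 e\<^sub>3 :: "'g vfield" +
  fixes J :: "'g tensor11" and D :: "'g connection" and \<alpha> \<beta> \<gamma> \<delta> :: real
  assumes bracket_12: "lie_bracket e\<^sub>1 e\<^sub>2 = - \<alpha> *\<^sub>R e\<^sub>1 - \<beta> *\<^sub>R e\<^sub>2 - \<beta> *\<^sub>R e\<^sub>3"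
    and bracket_13: "lie_bracket e\<^sub>1 e\<^sub>3 = \<alpha> *\<^sub>R e\<^sub>1 + \<beta> *\<^sub>R e\<^sub>2 + \<beta> *\<^sub>R e\<^sub>3"
    and bracket_23: "lie_bracket e\<^sub>2 e\<^sub>3 = \<gamma> *\<^sub>R e\<^sub>1 + \<delta> *\<^sub>R e\<^sub>2 + \<delta> *\<^sub>R e\<^sub>3"
    and product: "product_structure A J"
    and J_frame: "tensor_app J e\<^sub>1 = e\<^sub>1" "tensor_app J e\<^sub>2 = e\<^sub>2" "tensor_app J e\<^sub>3 = - e\<^sub>3"
    and levi_civita: "levi_civita A g D"

sublocale lie_group_G7 \<subseteq> connection_space A D
  using levi_civita by unfold_locales (simp add: levi_civita_def)

context lie_group_G7
begin

lemma bracket_frame: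
  "lie_bracket e\<^sub>1 e\<^sub>1 = comb 0 0 0" "lie_bracket e\<^sub>2 e\<^sub>2 = comb 0 0 0" "lie_bracket e\<^sub>3 e\<^sub>3 = comb 0 0 0"
  "lie_bracket e\<^sub>1 e\<^sub>2 = comb (- \<alpha>) (- \<beta>) (- \<beta>)" "lie_bracket e\<^sub>2 e\<^sub>1 = comb \<alpha> \<beta> \<beta>"
  "lie_bracket e\<^sub>1 e\<^sub>3 = comb \<alpha> \<beta> \<beta>" "lie_bracket e\<^sub>3 e\<^sub>1 = comb (- \<alpha>) (- \<beta>) (- \<beta>)"
  "lie_bracket e\<^sub>2 e\<^sub>3 = comb \<gamma> \<delta> \<delta>" "lie_bracket e\<^sub>3 e\<^sub>2 = comb (- \<gamma>) (- \<delta>) (- \<delta>)"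
proof -
  show *: "lie_bracket e\<^sub>1 e\<^sub>2 = comb (- \<alpha>) (- \<beta>) (- \<beta>)" "lie_bracket e\<^sub>1 e\<^sub>3 = comb \<alpha> \<beta> \<beta>"
    "lie_bracket e\<^sub>2 e\<^sub>3 = comb \<gamma> \<delta> \<delta>"
    by (simp_all add: comb_def bracket_12 bracket_13 bracket_23)
  show "lie_bracket e\<^sub>2 e\<^sub>1 = comb \<alpha> \<beta> \<beta>" "lie_bracket e\<^sub>3 e\<^sub>1 = comb (- \<alpha>) (- \<beta>) (- \<beta>)"
    "lie_bracket e\<^sub>3 e\<^sub>2 = comb (- \<gamma>) (- \<delta>) (- \<delta>)"
    by (simp_all add: lie_bracket_anticomm[of e\<^sub>2 e\<^sub>1] lie_bracket_anticomm[of e\<^sub>3 e\<^sub>1]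
        lie_bracket_anticomm[of e\<^sub>3 e\<^sub>2] * comb_uminus)
  show "lie_bracket e\<^sub>1 e\<^sub>1 = comb 0 0 0" "lie_bracket e\<^sub>2 e\<^sub>2 = comb 0 0 0" "lie_bracket e\<^sub>3 e\<^sub>3 = comb 0 0 0"
    by (simp_all add: comb_def lie_bracket_def fun_eq_iff)
qed

lemma bracket_comb:
  "lie_bracket (comb x\<^sub>1 x\<^sub>2 x\<^sub>3) (comb y\<^sub>1 y\<^sub>2 y\<^sub>3) =
    comb (- \<alpha> * (x\<^sub>1 * y\<^sub>2 - x\<^sub>2 * y\<^sub>1) + \<alpha> * (x\<^sub>1 * y\<^sub>3 - x\<^sub>3 * y\<^sub>1) + \<gamma> * (x\<^sub>2 * y\<^sub>3 - x\<^sub>3 * y\<^sub>2))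
      (- \<beta> * (x\<^sub>1 * y\<^sub>2 - x\<^sub>2 * y\<^sub>1) + \<beta> * (x\<^sub>1 * y\<^sub>3 - x\<^sub>3 * y\<^sub>1) + \<delta> * (x\<^sub>2 * y\<^sub>3 - x\<^sub>3 * y\<^sub>2))
      (- \<beta> * (x\<^sub>1 * y\<^sub>2 - x\<^sub>2 * y\<^sub>1) + \<beta> * (x\<^sub>1 * y\<^sub>3 - x\<^sub>3 * y\<^sub>1) + \<delta> * (x\<^sub>2 * y\<^sub>3 - x\<^sub>3 * y\<^sub>2))"
  unfolding comb_def[of x\<^sub>1] comb_def[of y\<^sub>1]
  by (simp add: lie_bracket_add_left lie_bracket_add_right lie_bracket_scaleR_left
      lie_bracket_scaleR_right bracket_frame comb_arith)
    (simp add: comb_eq_iff algebra_simps)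

lemma J_comb: "tensor_app J (comb x y z) = comb x y (- z)"
proof -
  have J: "J p (u + v) = J p u + J p v" "J p (c *\<^sub>R u) = c *\<^sub>R J p u"
    if "u \<in> tangent_space A p" "v \<in> tangent_space A p" for p u v c
    using product that unfolding product_structure_def tensor_field11_def by blast+
  have add: "tensor_app J (X + Y) = tensor_app J X + tensor_app J Y"
    if "X \<in> vector_fields A" "Y \<in> vector_fields A" for X Y
    using that by (simp add: tensor_app_def fun_eq_iff value_at_add J)
  have scale: "tensor_app J (c *\<^sub>R X) = c *\<^sub>R tensor_app J X" if "X \<in> vector_fields A" for c X
    using that J(2)[OF value_at_tangent[OF that] value_at_tangent[OF that]]
    by (simp only: tensor_app_def value_at_scaleR) (simp add: scaleR_fun_def fun_eq_iff)
  show ?thesis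
    by (simp add: comb_def add scale J_frame)
qed

text \<open>Metric compatibility applied to the constant products of the frame: up to the signs of
  the metric, the connection matrix is skew.\<close>

lemma levi_civita_metric:
  assumes "X \<in> vector_fields A"
  shows "metric_app g (D X e\<^sub>1) e\<^sub>1 p = 0" "metric_app g (D X e\<^sub>2) e\<^sub>2 p = 0"
    "metric_app g (D X e\<^sub>3) e\<^sub>3 p = 0"
    "metric_app g (D X e\<^sub>1) e\<^sub>2 p = - metric_app g (D X e\<^sub>2) e\<^sub>1 p"
    "metric_app g (D X e\<^sub>1) e\<^sub>3 p = - metric_app g (D X e\<^sub>3) e\<^sub>1 p"
    "metric_app g (D X e\<^sub>2) e\<^sub>3 p = - metric_app g (D X e\<^sub>3) e\<^sub>2 p"
proof -
  have one: "X 1 = 0"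
    using vf_apply_const[OF assms, of 1] by (simp add: one_fun_def)
  then have "X (- 1) = 0"
    using vf_apply_uminus[OF assms, of 1] smooth_const[of 1] by (simp add: one_fun_def)
  note const = one this vf_apply_zero[OF assms]
  have "X (metric_app g Y Z) = metric_app g (D X Y) Z + metric_app g (D X Z) Y"
    if "Y \<in> vector_fields A" "Z \<in> vector_fields A" for Y Z
  proof -
    have "X (metric_app g Y Z) = metric_app g (D X Y) Z + metric_app g Y (D X Z)"
      using levi_civita assms that unfolding levi_civita_def by blast
    also have "metric_app g Y (D X Z) = metric_app g (D X Z) Y"
      using assms that by (intro metric_app_commute) simp_all
    finally show ?thesis .
  qed
  then have compat: "metric_app g (D X Y) Z p + metric_app g (D X Z) Y p = X (metric_app g Y Z) p"
    if "Y \<in> vector_fields A" "Z \<in> vector_fields A" for Y Z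
    using that by (metis plus_fun_apply)
  note eqs = compat[OF frame_vf(1) frame_vf(1)] compat[OF frame_vf(2) frame_vf(2)]
    compat[OF frame_vf(3) frame_vf(3)] compat[OF frame_vf(1) frame_vf(2)]
    compat[OF frame_vf(1) frame_vf(3)] compat[OF frame_vf(2) frame_vf(3)]
  show "metric_app g (D X e\<^sub>1) e\<^sub>1 p = 0" "metric_app g (D X e\<^sub>2) e\<^sub>2 p = 0"
    "metric_app g (D X e\<^sub>3) e\<^sub>3 p = 0"
    "metric_app g (D X e\<^sub>1) e\<^sub>2 p = - metric_app g (D X e\<^sub>2) e\<^sub>1 p"
    "metric_app g (D X e\<^sub>1) e\<^sub>3 p = - metric_app g (D X e\<^sub>3) e\<^sub>1 p"
    "metric_app g (D X e\<^sub>2) e\<^sub>3 p = - metric_app g (D X e\<^sub>3) e\<^sub>2 p"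
    using eqs[unfolded metric_frame const zero_fun_apply] by linarith+
qed

text \<open>Vanishing torsion and the skewness relations form a linear system with a unique
  solution, the Koszul formula in a frame with constant products.\<close>

lemma levi_civita_frame:
  "D e\<^sub>1 e\<^sub>1 = comb 0 \<alpha> \<alpha>" "D e\<^sub>1 e\<^sub>2 = comb (- \<alpha>) 0 (\<gamma> / 2)" "D e\<^sub>1 e\<^sub>3 = comb \<alpha> (\<gamma> / 2) 0"
  "D e\<^sub>2 e\<^sub>1 = comb 0 \<beta> (\<gamma> / 2 + \<beta>)" "D e\<^sub>2 e\<^sub>2 = comb (- \<beta>) 0 \<delta>" "D e\<^sub>2 e\<^sub>3 = comb (\<gamma> / 2 + \<beta>) \<delta> 0"
  "D e\<^sub>3 e\<^sub>1 = comb 0 (\<gamma> / 2 - \<beta>) (- \<beta>)" "D e\<^sub>3 e\<^sub>2 = comb (\<beta> - \<gamma> / 2) 0 (- \<delta>)"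
  "D e\<^sub>3 e\<^sub>3 = comb (- \<beta>) (- \<delta>) 0"
proof -
  have torsion: "metric_app g (D X Y) e p = metric_app g (D Y X) e p + metric_app g (lie_bracket X Y) e p"
    if "X \<in> vector_fields A" "Y \<in> vector_fields A" "e \<in> vector_fields A" for X Y e p
  proof -
    have "D X Y - D Y X = lie_bracket X Y"
      using levi_civita that unfolding levi_civita_def by blast
    then have "D X Y = D Y X + lie_bracket X Y"
      by (metis add.commute diff_add_cancel)
    then show ?thesis
      using that by (simp add: metric_app_add_left)
  qed
  note torsion_frame = torsion[OF frame_vf(1) frame_vf(2), unfolded bracket_frame]
    torsion[OF frame_vf(1) frame_vf(3), unfolded bracket_frame]
    torsion[OF frame_vf(2) frame_vf(3), unfolded bracket_frame]
  note t = torsion_frame[OF frame_vf(1), unfolded metric_comb_frame]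
    torsion_frame[OF frame_vf(2), unfolded metric_comb_frame]
    torsion_frame[OF frame_vf(3), unfolded metric_comb_frame]
  note m = levi_civita_metric[OF frame_vf(1)] levi_civita_metric[OF frame_vf(2)]
    levi_civita_metric[OF frame_vf(3)]
  \<comment> \<open>Three components for each direction; skewness supplies the rest.\<close>
  have components:
    "metric_app g (D e\<^sub>1 e\<^sub>2) e\<^sub>1 p = - \<alpha>" "metric_app g (D e\<^sub>1 e\<^sub>3) e\<^sub>1 p = \<alpha>"
    "metric_app g (D e\<^sub>1 e\<^sub>3) e\<^sub>2 p = \<gamma> / 2" "metric_app g (D e\<^sub>2 e\<^sub>2) e\<^sub>1 p = - \<beta>"
    "metric_app g (D e\<^sub>2 e\<^sub>3) e\<^sub>1 p = \<gamma> / 2 + \<beta>" "metric_app g (D e\<^sub>2 e\<^sub>3) e\<^sub>2 p = \<delta>"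
    "metric_app g (D e\<^sub>3 e\<^sub>2) e\<^sub>1 p = \<beta> - \<gamma> / 2" "metric_app g (D e\<^sub>3 e\<^sub>3) e\<^sub>1 p = - \<beta>"
    "metric_app g (D e\<^sub>3 e\<^sub>3) e\<^sub>2 p = - \<delta>" for p
    using t[of p] m[of p] by linarith+
  show "D e\<^sub>1 e\<^sub>1 = comb 0 \<alpha> \<alpha>" "D e\<^sub>1 e\<^sub>2 = comb (- \<alpha>) 0 (\<gamma> / 2)" "D e\<^sub>1 e\<^sub>3 = comb \<alpha> (\<gamma> / 2) 0"
    "D e\<^sub>2 e\<^sub>1 = comb 0 \<beta> (\<gamma> / 2 + \<beta>)" "D e\<^sub>2 e\<^sub>2 = comb (- \<beta>) 0 \<delta>" "D e\<^sub>2 e\<^sub>3 = comb (\<gamma> / 2 + \<beta>) \<delta> 0"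
    "D e\<^sub>3 e\<^sub>1 = comb 0 (\<gamma> / 2 - \<beta>) (- \<beta>)" "D e\<^sub>3 e\<^sub>2 = comb (\<beta> - \<gamma> / 2) 0 (- \<delta>)"
    "D e\<^sub>3 e\<^sub>3 = comb (- \<beta>) (- \<delta>) 0"
    by (intro comb_eqI; simp add: components m)+
qed

lemma levi_civita_comb:
  "D (comb x\<^sub>1 x\<^sub>2 x\<^sub>3) (comb y\<^sub>1 y\<^sub>2 y\<^sub>3) =
    comb (- \<alpha> * x\<^sub>1 * y\<^sub>2 + \<alpha> * x\<^sub>1 * y\<^sub>3 - \<beta> * x\<^sub>2 * y\<^sub>2 + (\<gamma> / 2 + \<beta>) * x\<^sub>2 * y\<^sub>3
        + (\<beta> - \<gamma> / 2) * x\<^sub>3 * y\<^sub>2 - \<beta> * x\<^sub>3 * y\<^sub>3)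
      (\<alpha> * x\<^sub>1 * y\<^sub>1 + \<gamma> / 2 * x\<^sub>1 * y\<^sub>3 + \<beta> * x\<^sub>2 * y\<^sub>1 + \<delta> * x\<^sub>2 * y\<^sub>3
        + (\<gamma> / 2 - \<beta>) * x\<^sub>3 * y\<^sub>1 - \<delta> * x\<^sub>3 * y\<^sub>3)
      (\<alpha> * x\<^sub>1 * y\<^sub>1 + \<gamma> / 2 * x\<^sub>1 * y\<^sub>2 + (\<gamma> / 2 + \<beta>) * x\<^sub>2 * y\<^sub>1 + \<delta> * x\<^sub>2 * y\<^sub>2
        - \<beta> * x\<^sub>3 * y\<^sub>1 - \<delta> * x\<^sub>3 * y\<^sub>2)"
  unfolding comb_def[of x\<^sub>1] comb_def[of y\<^sub>1]
  by (simp add: conn_add_left conn_add_right conn_scaleR_left conn_scaleR_right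
      levi_civita_frame comb_arith)
    (simp add: comb_eq_iff algebra_simps)

text \<open>The outcome commutes with \<open>J\<close>: the first two coefficients involve only
  \<open>y\<^sub>1\<close> and \<open>y\<^sub>2\<close>, the third only
  \<open>y\<^sub>3\<close>.\<close>

lemma kobayashi_nomizu_comb:
  "kobayashi_nomizu D J (comb x\<^sub>1 x\<^sub>2 x\<^sub>3) (comb y\<^sub>1 y\<^sub>2 y\<^sub>3) =
    comb (- \<alpha> * x\<^sub>1 * y\<^sub>2 - \<beta> * x\<^sub>2 * y\<^sub>2 - \<alpha> * x\<^sub>3 * y\<^sub>1 - \<gamma> * x\<^sub>3 * y\<^sub>2)
      (\<alpha> * x\<^sub>1 * y\<^sub>1 + \<beta> * x\<^sub>2 * y\<^sub>1 - \<beta> * x\<^sub>3 * y\<^sub>1 - \<delta> * x\<^sub>3 * y\<^sub>2)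
      (\<beta> * x\<^sub>1 * y\<^sub>3 + \<delta> * x\<^sub>2 * y\<^sub>3)"
  by (simp add: kobayashi_nomizu_def canonical_connection_def nabla_J_def J_comb levi_civita_comb
      comb_arith)
    (simp add: comb_eq_iff field_simps)

lemma ricci_comb:
  "ricci g e\<^sub>1 e\<^sub>2 e\<^sub>3 (kobayashi_nomizu D J) (comb x\<^sub>1 x\<^sub>2 x\<^sub>3) (comb y\<^sub>1 y\<^sub>2 y\<^sub>3) =
    (\<lambda>_. - \<alpha>\<^sup>2 * x\<^sub>1 * y\<^sub>1 + \<beta> * \<delta> * x\<^sub>1 * y\<^sub>2 + \<beta> * (\<alpha> + \<delta>) * x\<^sub>1 * y\<^sub>3
      - \<alpha> * \<beta> * x\<^sub>2 * y\<^sub>1 - (\<alpha>\<^sup>2 + \<beta>\<^sup>2 + \<beta> * \<gamma>) * x\<^sub>2 * y\<^sub>2 + (\<delta>\<^sup>2 + \<beta> * \<gamma>) * x\<^sub>2 * y\<^sub>3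
      + \<beta> * (\<alpha> + \<delta>) * x\<^sub>3 * y\<^sub>1 + \<delta> * (\<alpha> + \<delta>) * x\<^sub>3 * y\<^sub>2)"
proof -
  let ?K = "kobayashi_nomizu D J"
  let ?R = "\<lambda>e. curvature ?K (comb x\<^sub>1 x\<^sub>2 x\<^sub>3) e (comb y\<^sub>1 y\<^sub>2 y\<^sub>3)"
  have "ricci g e\<^sub>1 e\<^sub>2 e\<^sub>3 ?K (comb x\<^sub>1 x\<^sub>2 x\<^sub>3) (comb y\<^sub>1 y\<^sub>2 y\<^sub>3) =
      - metric_app g (?R (comb 1 0 0)) e\<^sub>1 - metric_app g (?R (comb 0 1 0)) e\<^sub>2
      + metric_app g (?R (comb 0 0 1)) e\<^sub>3"
    by (simp add: ricci_def comb_unit)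
  then show ?thesis
    unfolding curvature_def bracket_comb kobayashi_nomizu_comb comb_arith metric_comb_frame
    by (simp add: fun_eq_iff algebra_simps power2_eq_square)
qed

lemma sym_ricci_comb:
  "sym_ricci g e\<^sub>1 e\<^sub>2 e\<^sub>3 (kobayashi_nomizu D J) (comb x\<^sub>1 x\<^sub>2 x\<^sub>3) (comb y\<^sub>1 y\<^sub>2 y\<^sub>3) =
    (\<lambda>_. - \<alpha>\<^sup>2 * x\<^sub>1 * y\<^sub>1 + \<beta> * (\<delta> - \<alpha>) / 2 * (x\<^sub>1 * y\<^sub>2 + x\<^sub>2 * y\<^sub>1)
      + \<beta> * (\<alpha> + \<delta>) * (x\<^sub>1 * y\<^sub>3 + x\<^sub>3 * y\<^sub>1) - (\<alpha>\<^sup>2 + \<beta>\<^sup>2 + \<beta> * \<gamma>) * x\<^sub>2 * y\<^sub>2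
      + (\<delta>\<^sup>2 + \<beta> * \<gamma> / 2 + \<alpha> * \<delta> / 2) * (x\<^sub>2 * y\<^sub>3 + x\<^sub>3 * y\<^sub>2))"
  unfolding sym_ricci_def ricci_comb scaleR_fun_def
  by (simp add: fun_eq_iff field_simps power2_eq_square)

text \<open>The Ricci components are constant, so differentiating them along the field gives 0 and
  only the bracket terms remain. The stated polynomials omit multiples of \<alpha>\<gamma>, hence
  the split into \<alpha> = 0 or \<gamma> = 0.\<close>

lemma lie_derivative_comb:
  assumes "\<alpha> * \<gamma> = 0"
  defines "L \<equiv> \<lambda>x y z. lie_derivative2 (comb x y z) (sym_ricci g e\<^sub>1 e\<^sub>2 e\<^sub>3 (kobayashi_nomizu D J))"
  shows
  "L x y z (comb 1 0 0) (comb 1 0 0) =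
    (\<lambda>_. (3 * \<beta>\<^sup>2 * \<delta> + \<alpha> * \<beta>\<^sup>2 - 2 * \<alpha>^3) * (z - y))" (is ?A)
  "L x y z (comb 1 0 0) (comb 0 1 0) =
    (\<lambda>_. \<beta> * \<delta>\<^sup>2 * (5/2 * z - y) + 3/2 * \<beta>\<^sup>2 * \<delta> * x
      - (\<beta>\<^sup>2 * \<gamma> / 2 + \<beta>^3 + 3/2 * \<alpha>\<^sup>2 * \<beta>) * (z - y) + \<alpha> * \<beta> * \<delta> * (3/2 * z - y)
      + (\<alpha> * \<beta>\<^sup>2 / 2 - \<alpha>^3) * x)" (is ?B)
  "L x y z (comb 1 0 0) (comb 0 0 1) =
    (\<lambda>_. \<beta> * \<delta>\<^sup>2 * (z - 5/2 * y) - 3/2 * \<beta>\<^sup>2 * \<delta> * x + (\<beta>\<^sup>2 * \<gamma> / 2 + \<alpha>\<^sup>2 * \<beta>) * (z - y)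
      + \<alpha> * \<beta> * \<delta> * (3/2 * z - 2 * y) - (\<alpha> * \<beta>\<^sup>2 / 2 - \<alpha>^3) * x)" (is ?C)
  "L x y z (comb 0 1 0) (comb 0 1 0) =
    (\<lambda>_. (2 * \<delta>^3 - 2 * \<beta>\<^sup>2 * \<delta> + \<alpha> * \<delta>\<^sup>2 - 2 * \<alpha>\<^sup>2 * \<delta>) * z
      + (2 * \<beta> * \<delta>\<^sup>2 - \<beta>\<^sup>2 * \<gamma> - 2 * \<beta>^3 + 2 * \<alpha> * \<beta> * \<delta> - 3 * \<alpha>\<^sup>2 * \<beta>) * x)" (is ?D)
  "L x y z (comb 0 1 0) (comb 0 0 1) =
    (\<lambda>_. (\<delta>^3 + \<alpha> * \<delta>\<^sup>2 / 2) * (z - y) + 3/2 * \<beta> * \<gamma> * \<delta> * z + (\<beta>\<^sup>2 + \<alpha>\<^sup>2) * \<delta> * y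
      + (\<beta>\<^sup>2 * \<gamma> + \<beta>^3 + \<alpha> * \<beta> * \<delta> / 2 + 5/2 * \<alpha>\<^sup>2 * \<beta>) * x)" (is ?E)
  "L x y z (comb 0 0 1) (comb 0 0 1) =
    (\<lambda>_. - (2 * \<delta>^3 + 3 * \<beta> * \<gamma> * \<delta> + \<alpha> * \<delta>\<^sup>2) * y
      - (2 * \<beta> * \<delta>\<^sup>2 + \<beta>\<^sup>2 * \<gamma> + 3 * \<alpha> * \<beta> * \<delta> + 2 * \<alpha>\<^sup>2 * \<beta>) * x)" (is ?F)
proof -
  have "\<alpha> = 0 \<or> \<gamma> = 0" using assms by simp
  then show ?A ?B ?C ?D ?E ?F
    by (auto simp: L_def lie_derivative2_def bracket_comb sym_ricci_comb vf_apply_const fun_eq_iff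
        field_simps power2_eq_square power3_eq_cube)
qed

end

section \<open>The equations of a Ricci collineation\<close>

text \<open>
  The components \<open>(1,1), (1,2), (1,3), (2,2), (2,3), (3,3)\<close> of the Lie derivative of the symmetrized
  Ricci tensor along \<open>x e\<^sub>1 + y e\<^sub>2 + z e\<^sub>3\<close>, for \<open>a, b, c, d\<close> in place of \<open>\<alpha>, \<beta>, \<gamma>, \<delta>\<close> and simplified by
  means of \<open>\<alpha>\<gamma> = 0\<close>.
\<close>

definition collineation_equations :: "real \<Rightarrow> real \<Rightarrow> real \<Rightarrow> real \<Rightarrow> real \<Rightarrow> real \<Rightarrow> real \<Rightarrow> bool" where
  "collineation_equations a b c d x y z \<longleftrightarrow>
    (3 * b\<^sup>2 * d + a * b\<^sup>2 - 2 * a^3) * (z - y) = 0 \<and>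
    b * d\<^sup>2 * (5/2 * z - y) + 3/2 * b\<^sup>2 * d * x
      - (b\<^sup>2 * c / 2 + b^3 + 3/2 * a\<^sup>2 * b) * (z - y) + a * b * d * (3/2 * z - y)
      + (a * b\<^sup>2 / 2 - a^3) * x = 0 \<and>
    b * d\<^sup>2 * (z - 5/2 * y) - 3/2 * b\<^sup>2 * d * x + (b\<^sup>2 * c / 2 + a\<^sup>2 * b) * (z - y)
      + a * b * d * (3/2 * z - 2 * y) - (a * b\<^sup>2 / 2 - a^3) * x = 0 \<and>
    (2 * d^3 - 2 * b\<^sup>2 * d + a * d\<^sup>2 - 2 * a\<^sup>2 * d) * z
      + (2 * b * d\<^sup>2 - b\<^sup>2 * c - 2 * b^3 + 2 * a * b * d - 3 * a\<^sup>2 * b) * x = 0 \<and>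
    (d^3 + a * d\<^sup>2 / 2) * (z - y) + 3/2 * b * c * d * z + (b\<^sup>2 + a\<^sup>2) * d * y
      + (b\<^sup>2 * c + b^3 + a * b * d / 2 + 5/2 * a\<^sup>2 * b) * x = 0 \<and>
    - (2 * d^3 + 3 * b * c * d + a * d\<^sup>2) * y
      - (2 * b * d\<^sup>2 + b\<^sup>2 * c + 3 * a * b * d + 2 * a\<^sup>2 * b) * x = 0"

section \<open>Solutions of the six equations, case by case\<close>

lemma collineation_equations_a0_c0:
  assumes "d \<noteq> 0" "b \<noteq> 0"
  shows "collineation_equations 0 b 0 d x y z \<longleftrightarrow> y = - (b / d) * x \<and> z = - (b / d) * x"
proof
  assume "collineation_equations 0 b 0 d x y z"
  note E = this[unfolded collineation_equations_def]
  note E11 = E[THEN conjunct1]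
    and E33 = E[THEN conjunct2, THEN conjunct2, THEN conjunct2, THEN conjunct2, THEN conjunct2]
  have "3 * b\<^sup>2 * d * (z - y) = 0"
    using E11 by simp
  moreover have "2 * d\<^sup>2 * (d * y + b * x) = 0"
    using E33 by (simp add: algebra_simps power2_eq_square power3_eq_cube)
  ultimately have "z = y" and "d * y = - b * x"
    using assms by (simp_all add: eq_neg_iff_add_eq_0)
  then show "y = - (b / d) * x \<and> z = - (b / d) * x"
    using assms by (simp add: field_simps)
next
  assume "y = - (b / d) * x \<and> z = - (b / d) * x"
  \<comment> \<open>Clears the denominator, so that the equations become polynomial
    identities.\<close>
  moreover define k where "k = x / d"
  ultimately have "x = d * k" "y = - b * k" "z = - b * k"
    using assms by simp_all
  then show "collineation_equations 0 b 0 d x y z"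
    by (simp add: collineation_equations_def algebra_simps power2_eq_square power3_eq_cube)
qed

text \<open>Here \<open>c\<close> occurs only with the factor \<open>b\<close> and drops out; (2,2)
  and (3,3) read 2 d^3 z = 0 and - 2 d^3 y = 0.\<close>

lemma collineation_equations_a0_b0:
  assumes "d \<noteq> 0"
  shows "collineation_equations 0 0 c d x y z \<longleftrightarrow> y = 0 \<and> z = 0"
  using assms by (auto simp: collineation_equations_def)

lemma collineation_equations_a0:
  assumes "d \<noteq> 0" "b \<noteq> 0" "c \<noteq> 0"
  shows "collineation_equations 0 b c d x y z \<longleftrightarrow> x = 0 \<and> y = 0 \<and> z = 0"
proof
  assume eqs: "collineation_equations 0 b c d x y z"
  note E = eqs[unfolded collineation_equations_def]
  note E11 = E[THEN conjunct1]
    and E12 = E[THEN conjunct2, THEN conjunct1]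
    and E33 = E[THEN conjunct2, THEN conjunct2, THEN conjunct2, THEN conjunct2, THEN conjunct2]
  have "3 * b\<^sup>2 * d * (z - y) = 0"
    using E11 by simp
  then have z: "z = y" using assms by simp
  have "b * d * (d * y + b * x) = 2/3 * (b * d\<^sup>2 * (5/2 * y - y) + 3/2 * b\<^sup>2 * d * x)"
    by (simp add: algebra_simps power2_eq_square)
  also have "\<dots> = 0"
    using E12 z by simp
  finally have "d * y + b * x = 0"
    using assms by simp
  then have dy: "d * y = - b * x"
    by (simp add: eq_neg_iff_add_eq_0)
  have "- (2 * d^3 + 3 * b * c * d) * y - (2 * b * d\<^sup>2 + b\<^sup>2 * c) * x = 0"
    using E33 by simp
  \<comment> \<open>Inserting d y = - b x cancels the terms without \<open>c\<close> and leaves a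
    multiple of b^2 c x.\<close>
  with dy have "b\<^sup>2 * c * x = 0"
    by algebra
  then have "x = 0" using assms by simp
  with dy z show "x = 0 \<and> y = 0 \<and> z = 0" using assms by simp
qed (simp add: collineation_equations_def)

lemma collineation_equations_c0_d0:
  assumes "a \<noteq> 0"
  shows "collineation_equations a b 0 0 x y z \<longleftrightarrow> x = 0 \<and> y = z"
proof
  assume eqs: "collineation_equations a b 0 0 x y z"
  note E33 = eqs[unfolded collineation_equations_def, THEN conjunct2, THEN conjunct2,
      THEN conjunct2, THEN conjunct2, THEN conjunct2]
  from E33 have "2 * a\<^sup>2 * b * x = 0"
    by simp
  then have bx: "b * x = 0" using assms by simp
  show "x = 0 \<and> y = z"
  proof (cases "b = 0")
    case True
    with eqs assms show ?thesis by (auto simp: collineation_equations_def)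
  next
    \<comment> \<open>Now x = 0, and the (1,3) equation becomes a^2 b (z - y) = 0; the coefficient
      in (1,1) may vanish here.\<close>
    case False
    with eqs bx assms show ?thesis by (auto simp: collineation_equations_def)
  qed
qed (simp add: collineation_equations_def)

lemma collineation_equations_c0:
  assumes "a \<noteq> 0" "d \<noteq> 0" "a + d \<noteq> 0"
  shows "collineation_equations a b 0 d x y z \<longleftrightarrow> x = 0 \<and> y = 0 \<and> z = 0"
proof
  assume eqs: "collineation_equations a b 0 d x y z"
  note E = eqs[unfolded collineation_equations_def]
  note E11 = E[THEN conjunct1]
    and E12 = E[THEN conjunct2, THEN conjunct1]
    and E13 = E[THEN conjunct2, THEN conjunct2, THEN conjunct1]
    and E22 = E[THEN conjunct2, THEN conjunct2, THEN conjunct2, THEN conjunct1]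
    and E23 = E[THEN conjunct2, THEN conjunct2, THEN conjunct2, THEN conjunct2, THEN conjunct1]
    and E33 = E[THEN conjunct2, THEN conjunct2, THEN conjunct2, THEN conjunct2, THEN conjunct2]
  define u where "u = z - y"
  have z: "z = y + u" by (simp add: u_def)
  show "x = 0 \<and> y = 0 \<and> z = 0"
  proof (cases "b = 0")
    case True
    with E11 assms have "z = y" by (simp add: u_def)
    with True eqs assms show ?thesis by (auto simp: collineation_equations_def)
  next
    case b: False
    have u: "u = 0"
    proof (rule ccontr)
      assume u: "u \<noteq> 0"
      have "b * u * (7 * d\<^sup>2 + 6 * a * d - a\<^sup>2 - 2 * b\<^sup>2) = 0"
        using E12 E13 z by algebra  \<comment> \<open>\<open>E12 + E13\<close>\<close>
      then have "7 * d\<^sup>2 + 6 * a * d - a\<^sup>2 - 2 * b\<^sup>2 = 0"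
        using u b by simp
      moreover have "2 * d * u * (2 * d\<^sup>2 + a * d - b\<^sup>2 - a\<^sup>2) = 0"
        using E22 E23 E33 z by algebra  \<comment> \<open>\<open>E22 + 2 E23 + E33\<close>\<close>
      then have "2 * d\<^sup>2 + a * d - b\<^sup>2 - a\<^sup>2 = 0"
        using u assms by simp
      \<comment> \<open>The first relation minus twice the second eliminates \<open>b\<close>. The
        remaining possibility a = - 3 d turns the coefficient in (1,1) into 54 d^3.\<close>
      ultimately have "(3 * d + a) * (a + d) = 0"
        by algebra
      then have "a = - 3 * d" using assms by simp
      moreover have "3 * b\<^sup>2 * d + a * b\<^sup>2 - 2 * a^3 = 0"
        using E11 u by (simp add: u_def)
      ultimately show False using assms by simp
    qed
    then have zy: "z = y" by (simp add: u_def)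
    have x: "x = 0"
    proof (rule ccontr)
      assume x: "x \<noteq> 0"
      \<comment> \<open>\<open>w\<close> measures the deviation from d y = - b x, the solution line
        for \<alpha> = \<gamma> = 0. In \<open>w\<close> and \<open>s\<close> the equations (3,3),
        (2,3) and (1,2) become proportionalities.\<close>
      define s where "s = b * x"
      define w where "w = d * y + s"
      have "s \<noteq> 0" using b x by (simp add: s_def)
      have 1: "d * (2 * d + a) * w = - 2 * a * (a + d) * s"
        using E33 zy s_def w_def by algebra
      have 2: "2 * (b\<^sup>2 + a\<^sup>2) * w = - a * (d + 3 * a) * s"
        using E23 zy s_def w_def by algebra
      have 3: "b\<^sup>2 * (3 * d + a) * w = 2 * a^3 * s"
        using E12 zy s_def w_def by algebra
      have "w \<noteq> 0" using 3 \<open>s \<noteq> 0\<close> assms by auto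
      \<comment> \<open>Cross-multiplying two proportionalities eliminates the ratio of
        \<open>w\<close> to \<open>s\<close>.\<close>
      have "2 * a * w * s * (a\<^sup>2 * d * (2 * d + a) + b\<^sup>2 * (a + d) * (3 * d + a)) = 0"
        using 1 3 by algebra
      moreover have "a * w * s * (4 * a\<^sup>2 * (b\<^sup>2 + a\<^sup>2) + b\<^sup>2 * (d + 3 * a) * (3 * d + a)) = 0"
        using 2 3 by algebra
      ultimately have F1: "a\<^sup>2 * d * (2 * d + a) + b\<^sup>2 * (a + d) * (3 * d + a) = 0"
        and F2: "4 * a\<^sup>2 * (b\<^sup>2 + a\<^sup>2) + b\<^sup>2 * (d + 3 * a) * (3 * d + a) = 0"
        using \<open>w \<noteq> 0\<close> \<open>s \<noteq> 0\<close> assms by simp_all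
      \<comment> \<open>Both relations are homogeneous of degree 4 in a, b, d; dividing by a^4
        leaves only the ratios \<open>r\<close> and \<open>q\<close>.\<close>
      define r where "r = d / a"
      define q where "q = (b / a)\<^sup>2"
      have d: "d = r * a" and bq: "b\<^sup>2 = q * a\<^sup>2" and "q > 0"
        using assms b by (simp_all add: r_def q_def power_divide)
      have "a^4 * (r * (2 * r + 1) + q * ((r + 1) * (3 * r + 1))) = 0"
        using F1 unfolding d bq by algebra
      then have F1': "r * (2 * r + 1) + q * ((r + 1) * (3 * r + 1)) = 0"
        using assms by simp
      have "a^4 * (4 + q * ((3 * r + 7) * (r + 1))) = 0"
        using F2 unfolding d bq by algebra
      then have "q * ((3 * r + 7) * (r + 1)) = - 4"
        using assms by simp
      then have "q * ((3 * r + 7) * (r + 1)) < 0" by simp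
      then have "(3 * r + 7) * (r + 1) < 0"
        using \<open>q > 0\<close> by (simp add: mult_less_0_iff)
      \<comment> \<open>The opposite sign pattern would require r > - 1 and r < - 7/3. For r < - 1
        both summands of \<open>F1'\<close> are positive.\<close>
      then have "r < - 1" by (auto simp: mult_less_0_iff)
      then have "r * (2 * r + 1) > 0" and "(r + 1) * (3 * r + 1) > 0"
        by (simp_all add: mult_neg_neg)
      with F1' \<open>q > 0\<close> show False
        using mult_pos_pos[of q "(r + 1) * (3 * r + 1)"] by linarith
    qed
    have "(b\<^sup>2 + a\<^sup>2) * d * y = 0"
      using E23 x zy by simp
    moreover have "b\<^sup>2 + a\<^sup>2 \<noteq> 0"
      using assms by (simp add: sum_power2_eq_zero_iff)
    ultimately have "y = 0" using assms by simp
    with x zy show ?thesis by simp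
  qed
qed (simp add: collineation_equations_def)

text \<open>Tensoriality of the Lie derivative reduces the condition on all vector fields to its six
  frame components, which are constants.\<close>

lemma (in lie_group_G7) ricci_collineations_eq:
  assumes "\<alpha> * \<gamma> = 0"
  shows "ricci_collineations A g J D e\<^sub>1 e\<^sub>2 e\<^sub>3 =
    {comb x y z |x y z. collineation_equations \<alpha> \<beta> \<gamma> \<delta> x y z}"
proof -
  let ?S = "sym_ricci g e\<^sub>1 e\<^sub>2 e\<^sub>3 (kobayashi_nomizu D J)"
  have "sym_tensor02 A ?S"
    using product atlas connection
    by (intro sym_tensor02_sym_ricci affine_connection_kobayashi_nomizu)
      (simp_all add: product_structure_def)
  then have L: "sym_tensor02 A (lie_derivative2 (comb x y z) ?S)" for x y z
    by (intro sym_tensor02_lie_derivative2) simp_all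
  have "(\<forall>X\<in>vector_fields A. \<forall>Y\<in>vector_fields A. lie_derivative2 (comb x y z) ?S X Y = 0) \<longleftrightarrow>
      collineation_equations \<alpha> \<beta> \<gamma> \<delta> x y z" (is "?lhs \<longleftrightarrow> _") for x y z
  proof -
    let ?L = "lie_derivative2 (comb x y z) ?S"
    have "?lhs \<longleftrightarrow> ?L e\<^sub>1 e\<^sub>1 = 0 \<and> ?L e\<^sub>1 e\<^sub>2 = 0 \<and> ?L e\<^sub>1 e\<^sub>3 = 0 \<and>
        ?L e\<^sub>2 e\<^sub>2 = 0 \<and> ?L e\<^sub>2 e\<^sub>3 = 0 \<and> ?L e\<^sub>3 e\<^sub>3 = 0"
      using sym_tensor02_zeroI[OF L, of x y z] frame_vf by blast
    also have "\<dots> \<longleftrightarrow> collineation_equations \<alpha> \<beta> \<gamma> \<delta> x y z"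
      by (simp only: lie_derivative_comb[OF assms, unfolded comb_unit] zero_fun_def fun_eq_iff
          collineation_equations_def simp_thms)
    finally show ?thesis .
  qed
  then show ?thesis
    unfolding ricci_collineations_def left_invariant_fields_eq by blast
qed

theorem theorem4p21:
  fixes A :: "('g::{topological_group_add, t2_space, second_countable_topology}) atlas"
    and g :: "'g metric" and J :: "'g tensor11" and D :: "'g connection"
    and e\<^sub>1 e\<^sub>2 e\<^sub>3 :: "'g vfield"
    and \<alpha> \<beta> \<gamma> \<delta> :: real
  assumes "\<alpha> + \<delta> \<noteq> 0" and "\<alpha> * \<gamma> = 0"
    and "lie_group A" and "connected (UNIV :: 'g set)"
    and "lorentzian_metric A g" and "left_invariant_metric A g"
    and "lie_algebra_basis A e\<^sub>1 e\<^sub>2 e\<^sub>3" and "pseudo_orthonormal g e\<^sub>1 e\<^sub>2 e\<^sub>3"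
    and "lie_bracket e\<^sub>1 e\<^sub>2 = - \<alpha> *\<^sub>R e\<^sub>1 - \<beta> *\<^sub>R e\<^sub>2 - \<beta> *\<^sub>R e\<^sub>3"
    and "lie_bracket e\<^sub>1 e\<^sub>3 = \<alpha> *\<^sub>R e\<^sub>1 + \<beta> *\<^sub>R e\<^sub>2 + \<beta> *\<^sub>R e\<^sub>3"
    and "lie_bracket e\<^sub>2 e\<^sub>3 = \<gamma> *\<^sub>R e\<^sub>1 + \<delta> *\<^sub>R e\<^sub>2 + \<delta> *\<^sub>R e\<^sub>3"
    and "product_structure A J" and "left_invariant_tensor11 A J"
    and "tensor_app J e\<^sub>1 = e\<^sub>1" and "tensor_app J e\<^sub>2 = e\<^sub>2" and "tensor_app J e\<^sub>3 = - e\<^sub>3"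
    and "levi_civita A g D"
  shows "((\<exists>\<xi>\<in>ricci_collineations A g J D e\<^sub>1 e\<^sub>2 e\<^sub>3. \<xi> \<noteq> 0) \<longleftrightarrow>
            (\<alpha> = 0 \<and> \<delta> \<noteq> 0 \<and> \<beta> \<noteq> 0 \<and> \<gamma> = 0) \<or>
            (\<alpha> = 0 \<and> \<delta> \<noteq> 0 \<and> \<beta> = 0) \<or>
            (\<alpha> \<noteq> 0 \<and> \<gamma> = 0 \<and> \<delta> = 0)) \<and>
         (\<alpha> = 0 \<and> \<delta> \<noteq> 0 \<and> \<beta> \<noteq> 0 \<and> \<gamma> = 0 \<longrightarrow>
            ricci_collineations A g J D e\<^sub>1 e\<^sub>2 e\<^sub>3 =
              span {e\<^sub>1 - (\<beta> / \<delta>) *\<^sub>R e\<^sub>2 - (\<beta> / \<delta>) *\<^sub>R e\<^sub>3}) \<and>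
         (\<alpha> = 0 \<and> \<delta> \<noteq> 0 \<and> \<beta> = 0 \<longrightarrow>
            ricci_collineations A g J D e\<^sub>1 e\<^sub>2 e\<^sub>3 = span {e\<^sub>1}) \<and>
         (\<alpha> \<noteq> 0 \<and> \<gamma> = 0 \<and> \<delta> = 0 \<longrightarrow>
            ricci_collineations A g J D e\<^sub>1 e\<^sub>2 e\<^sub>3 = span {e\<^sub>2 + e\<^sub>3})"
proof -
  interpret lie_group_G7 A g e\<^sub>1 e\<^sub>2 e\<^sub>3 J D \<alpha> \<beta> \<gamma> \<delta>
    using assms by unfold_locales
  let ?RC = "ricci_collineations A g J D e\<^sub>1 e\<^sub>2 e\<^sub>3"
  note RC = ricci_collineations_eq[OF \<open>\<alpha> * \<gamma> = 0\<close>]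
  have zero: "0 = comb 0 0 0"
    by (simp add: comb_def)
  have span_comb: "span {comb x y z} = {comb (k * x) (k * y) (k * z) |k. True}" for x y z
    by (auto simp: span_singleton comb_scaleR)
  have nonzero: "\<exists>\<xi>\<in>span {comb x y z}. \<xi> \<noteq> 0" if "comb x y z \<noteq> 0" for x y z
    using that span_base by blast
  have 1: "?RC = span {comb 1 (- (\<beta> / \<delta>)) (- (\<beta> / \<delta>))}" if "\<alpha> = 0" "\<delta> \<noteq> 0" "\<beta> \<noteq> 0" "\<gamma> = 0"
    unfolding RC span_comb using that by (auto simp: collineation_equations_a0_c0 mult.commute)
  have 2: "?RC = span {comb 1 0 0}" if "\<alpha> = 0" "\<delta> \<noteq> 0" "\<beta> = 0"
    unfolding RC span_comb using that by (auto simp: collineation_equations_a0_b0)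
  have 3: "?RC = span {comb 0 1 1}" if "\<alpha> \<noteq> 0" "\<gamma> = 0" "\<delta> = 0"
    unfolding RC span_comb using that by (auto simp: collineation_equations_c0_d0)
  \<comment> \<open>By \<alpha> + \<delta> \<noteq> 0 and \<alpha>\<gamma> = 0, outside the three
    cases either \<alpha> = 0 with \<beta>, \<gamma>, \<delta> nonzero, or \<gamma> = 0 with
    \<alpha>, \<delta> nonzero.\<close>
  have 4: "?RC = {0}" if "\<not> (\<alpha> = 0 \<and> \<delta> \<noteq> 0 \<and> \<beta> \<noteq> 0 \<and> \<gamma> = 0)"
    "\<not> (\<alpha> = 0 \<and> \<delta> \<noteq> 0 \<and> \<beta> = 0)" "\<not> (\<alpha> \<noteq> 0 \<and> \<gamma> = 0 \<and> \<delta> = 0)"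
  proof (cases "\<alpha> = 0")
    case True
    with that assms(1) show ?thesis
      unfolding RC by (auto simp: collineation_equations_a0 zero)
  next
    case False
    with that assms(1,2) show ?thesis
      unfolding RC by (auto simp: collineation_equations_c0 zero)
  qed
  have "(\<exists>\<xi>\<in>?RC. \<xi> \<noteq> 0) \<longleftrightarrow> (\<alpha> = 0 \<and> \<delta> \<noteq> 0 \<and> \<beta> \<noteq> 0 \<and> \<gamma> = 0) \<or>
      (\<alpha> = 0 \<and> \<delta> \<noteq> 0 \<and> \<beta> = 0) \<or> (\<alpha> \<noteq> 0 \<and> \<gamma> = 0 \<and> \<delta> = 0)" (is "_ \<longleftrightarrow> ?cases")
  proof
    show ?cases if "\<exists>\<xi>\<in>?RC. \<xi> \<noteq> 0"
      using that 4 by blast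
    have "comb 1 (- (\<beta> / \<delta>)) (- (\<beta> / \<delta>)) \<noteq> 0" "comb 1 0 0 \<noteq> 0" "comb 0 1 1 \<noteq> 0"
      unfolding zero comb_eq_iff by simp_all
    then show "\<exists>\<xi>\<in>?RC. \<xi> \<noteq> 0" if ?cases
      using that 1 2 3 nonzero by metis
  qed
  with 1 2 3 show ?thesis
    by (auto simp: comb_def)
qed

end
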